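(* Let $n\ge 1$ and $k\ge n$ be integers, and let $K$ be the transition matrix of the Burnside process on $[k]^n$ (defined in the context), with stationary distribution $$\pi(u)=\frac{1}{B_n\,|O_u|},\qquad u\in[k]^n.$$ Then for every starting state $u\in[k]^n$ and every integer $t\ge 0$, $$\|K_u^t-\pi\|_{TV}\le n\left(1-\frac{1}{2k}\right)^t .$$ Consequently, for every $\epsilon>0$ the mixing time of $K$ satisfies $$t_{\mathrm{mix}}(\epsilon)\le 2k\log\left(\frac{n}{\epsilon}\right).$$
   Context: $[k]=\{1,\dots,k\}$. The symmetric group $S_k$ acts on $[k]^n$ by $\sigma(u_1,\dots,u_n)=(\sigma(u_1),\dots,\sigma(u_n))$. For $u\in[k]^n$, $O_u=\{\sigma u:\sigma\in S_k\}$ is its orbit and $G_u=\{\sigma\in S_k:\sigma u=u\}$ its stabilizer; for $\sigma\in S_k$, $X_\sigma=\{v\in[k]^n:\sigma v=v\}$. The Burnside process on $[k]^n$ is the Markov chain which, from state $u$, (1) lets $J\subseteq[k]$ be the set of values appearing among the coordinates of $u$ and chooses $\sigma$ uniformly at random among permutations of $[k]$ fixing every element of $J$ (i.e. uniformly from $G_u$); (2) then produces $v\in[k]^n$ by choosing each coordinate independently and uniformly from the set of fixed points of $\sigma$. Equivalently $K(u,v)=\sum_{\sigma\in G_u\cap G_v}\frac{1}{|G_u|\,|X_\sigma|}$. $B_n$ is the $n$th Bell number (number of set partitions of $[n]$); the orbits of this action correspond to set partitions of $[n]$. $K_u^t=K^t(u,\cdot)$, $\|\mu-\nu\|_{TV}=\frac12\sum_y|\mu(y)-\nu(y)|$,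 and $t_{\mathrm{mix}}(\epsilon)=\min\{t:\max_{u}\|K_u^t-\pi\|_{TV}\le\epsilon\}$.
   Formalization: The mixing-time bound is stated for 0 < ε ≤ n rather than every ε > 0: for ε > n the right-hand side 2k log(n/ε) is negative while the mixing time is 0, so the claim fails there. *)

theory Defs
  imports "HOL-Analysis.Analysis" "HOL-Combinatorics.Permutations" "HOL-Library.Disjoint_Sets"
begin

definition states :: "nat \<Rightarrow> nat \<Rightarrow> (nat \<Rightarrow> nat) set" where
  "states k n = PiE {..<n} (\<lambda>_. {1..k})"

definition act :: "nat \<Rightarrow> (nat \<Rightarrow> nat) \<Rightarrow> (nat \<Rightarrow> nat) \<Rightarrow> (nat \<Rightarrow> nat)" where
  "act n \<sigma> u = restrict (\<lambda>i. \<sigma> (u i)) {..<n}"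

definition orbit :: "nat \<Rightarrow> nat \<Rightarrow> (nat \<Rightarrow> nat) \<Rightarrow> (nat \<Rightarrow> nat) set" where
  "orbit k n u = {act n \<sigma> u | \<sigma>. \<sigma> permutes {1..k}}"

definition stab :: "nat \<Rightarrow> nat \<Rightarrow> (nat \<Rightarrow> nat) \<Rightarrow> (nat \<Rightarrow> nat) set" where
  "stab k n u = {\<sigma>. \<sigma> permutes {1..k} \<and> act n \<sigma> u = u}"

definition fixset :: "nat \<Rightarrow> nat \<Rightarrow> (nat \<Rightarrow> nat) \<Rightarrow> (nat \<Rightarrow> nat) set" where
  "fixset k n \<sigma> = {v \<in> states k n. act n \<sigma> v = v}"

definition burnsideK :: "nat \<Rightarrow> nat \<Rightarrow> (nat \<Rightarrow> nat) \<Rightarrow> (nat \<Rightarrow> nat) \<Rightarrow> real" where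
  "burnsideK k n u v =
     (\<Sum>\<sigma> \<in> stab k n u \<inter> stab k n v.
        1 / (real (card (stab k n u)) * real (card (fixset k n \<sigma>))))"

fun burnsideK_pow :: "nat \<Rightarrow> nat \<Rightarrow> nat \<Rightarrow> (nat \<Rightarrow> nat) \<Rightarrow> (nat \<Rightarrow> nat) \<Rightarrow> real" where
  "burnsideK_pow k n 0 u v = (if u = v then 1 else 0)"
| "burnsideK_pow k n (Suc t) u v =
     (\<Sum>w \<in> states k n. burnsideK_pow k n t u w * burnsideK k n w v)"

definition Bell :: "nat \<Rightarrow> nat" where
  "Bell n = card {P. partition_on {..<n} P}"

definition burnside_pi :: "nat \<Rightarrow> nat \<Rightarrow> (nat \<Rightarrow> nat) \<Rightarrow> real" where
  "burnside_pi k n u = 1 / (real (Bell n) * real (card (orbit k n u)))"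

definition tv_dist :: "nat \<Rightarrow> nat \<Rightarrow> nat \<Rightarrow> (nat \<Rightarrow> nat) \<Rightarrow> real" where
  "tv_dist k n t u =
     (1/2) * (\<Sum>v \<in> states k n. \<bar>burnsideK_pow k n t u v - burnside_pi k n v\<bar>)"

definition tmix :: "nat \<Rightarrow> nat \<Rightarrow> real \<Rightarrow> nat" where
  "tmix k n \<epsilon> = (LEAST t. \<forall>u \<in> states k n. tv_dist k n t u \<le> \<epsilon>)"

end

theory Submission
  imports Defs
begin

text \<open>One step of the chain depends on the current tuple only through its value set \<open>J\<close>, so a
  test function turns after one step into a function \<open>H\<close> of \<open>J\<close>, and the total variation distance
  splits into the dependence of \<open>H\<close> on the labels in \<open>J\<close> and the dependence of its mean over all
  relabellings on \<open>card J\<close>.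

  Labels: exchanging one used value for an unused one changes \<open>H\<close> by an amount that a step reduces
  by the factor \<open>1 - 1 / (k - 1)\<close>, because the chosen permutation may fix the unused value. Two
  value sets of equal size are at most \<open>n\<close> exchanges apart.

  Sizes: the block count evolves by adding the fixed points of a random permutation of the unused
  values and then throwing \<open>n\<close> balls into that many boxes and counting the occupied ones. Both
  steps are stochastically monotone. A step therefore contracts every function whose increments are
  dominated by those of \<open>f j = 3 * k * j - j\<^sup>2\<close> as soon as it contracts \<open>f\<close> itself, and the latter
  follows from the first two moments of the number of fixed points, with factor
  \<open>1 - 2 / (3 * k - 3)\<close>.

  Both rates beat \<open>1 - 1 / (2 * k)\<close>. As total variation is at most \<open>1\<close>, only large \<open>t\<close> matter, and
  there the gap between the rates compensates for the constants.\<close>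

section \<open>Fixed points of random permutations\<close>

text \<open>The mean of \<open>\<phi>\<close> over the number of fixed points of a uniform
  permutation of N points. Of the \<open>N + 1\<close> ways to insert a further point, one fixes it,
  x destroy one of the x present fixed points, and \<open>N - x\<close> leave their number
  unchanged. At \<open>x = 0\<close> the truncated \<open>x - 1\<close> carries the weight
  0.\<close>

fun fix_mean :: "nat \<Rightarrow> (nat \<Rightarrow> real) \<Rightarrow> real" where
  "fix_mean 0 \<phi> = \<phi> 0"
| "fix_mean (Suc N) \<phi> =
     fix_mean N (\<lambda>x. (\<phi> (Suc x) + real x * \<phi> (x - 1) + (real N - real x) * \<phi> x) / (real N + 1))"

text \<open>Every permutation of \<open>insert a S\<close> is
  \<open>Transposition.transpose a b \<circ> q\<close> for exactly one q on S and one b: it sends a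
  to b and the q-preimage of b to a. The inner sum over b is the recursion of
  \<open>fix_mean\<close>.\<close>

lemma sum_permutes_fixpoints:
  assumes "finite A"
  shows "(\<Sum>\<sigma> | \<sigma> permutes A. \<phi> (card {x \<in> A. \<sigma> x = x})) = fact (card A) * fix_mean (card A) \<phi>"
  using assms
proof (induction A arbitrary: \<phi> rule: finite_induct)
  case empty
  then show ?case by simp
next
  case (insert a S)
  let ?x = "\<lambda>q. card {x \<in> S. q x = x}"
  have fixed_same: "card {x \<in> insert a S. (Transposition.transpose a a \<circ> q) x = x} = Suc (?x q)" if q: "q permutes S" for q
  proof -
    have "{x \<in> insert a S. (Transposition.transpose a a \<circ> q) x = x} = insert a {x \<in> S. q x = x}"
      using q insert.hyps by (auto simp: permutes_not_in)
    with insert.hyps show ?thesis by simp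
  qed
  have fixed_other: "card {x \<in> insert a S. (Transposition.transpose a b \<circ> q) x = x} =
      (if q b = b then ?x q - 1 else ?x q)" if q: "q permutes S" and b: "b \<in> S" for q b
  proof -
    have "q a = a" using q insert.hyps by (simp add: permutes_not_in)
    moreover have "a \<noteq> b" using b insert.hyps by auto
    moreover have "q x \<noteq> a" if "x \<in> S" for x
      using permutes_in_image[OF q, of x] that insert.hyps by auto
    ultimately have "{x \<in> insert a S. (Transposition.transpose a b \<circ> q) x = x} = {x \<in> S. q x = x} - {b}"
      using insert.hyps by (auto simp: Transposition.transpose_def split: if_splits)
    then show ?thesis using b insert.hyps by (auto simp: card_Diff_singleton_if)
  qed
  have inner: "(\<Sum>b\<in>insert a S. \<phi> (card {x \<in> insert a S. (Transposition.transpose a b \<circ> q) x = x})) =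
      \<phi> (Suc (?x q)) + real (?x q) * \<phi> (?x q - 1) + (real (card S) - real (?x q)) * \<phi> (?x q)"
    if q: "q permutes S" for q
  proof -
    have "(\<Sum>b\<in>S. \<phi> (card {x \<in> insert a S. (Transposition.transpose a b \<circ> q) x = x})) =
        (\<Sum>b\<in>S. if q b = b then \<phi> (?x q - 1) else \<phi> (?x q))"
      using fixed_other[OF q] by (intro sum.cong) auto
    also have "\<dots> = real (?x q) * \<phi> (?x q - 1) + real (card (S \<inter> - {b. q b = b})) * \<phi> (?x q)"
      using insert.hyps by (simp add: sum.If_cases Int_def conj_commute)
    also have "card (S \<inter> - {b. q b = b}) = card S - ?x q"
    proof -
      have "S \<inter> - {b. q b = b} = S - {x \<in> S. q x = x}" by auto
      then show ?thesis using insert.hyps by (simp add: card_Diff_subset)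
    qed
    also have "real (card S - ?x q) = real (card S) - real (?x q)"
      using insert.hyps by (intro of_nat_diff card_mono) auto
    finally show ?thesis
      using fixed_same[OF q] insert.hyps by (simp add: sum.insert[OF insert.hyps])
  qed
  have "(\<Sum>\<sigma> | \<sigma> permutes insert a S. \<phi> (card {x \<in> insert a S. \<sigma> x = x})) =
      (\<Sum>q | q permutes S. \<Sum>b\<in>insert a S. \<phi> (card {x \<in> insert a S. (Transposition.transpose a b \<circ> q) x = x}))"
    by (subst sum_over_permutations_insert[OF insert.hyps]) (rule sum.swap)
  also have "\<dots> = (\<Sum>q | q permutes S. (real (card S) + 1) *
      ((\<phi> (Suc (?x q)) + real (?x q) * \<phi> (?x q - 1) + (real (card S) - real (?x q)) * \<phi> (?x q)) / (real (card S) + 1)))"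
  proof (intro sum.cong refl)
    fix q assume "q \<in> {q. q permutes S}"
    then have "q permutes S" by simp
    from inner[OF this]
    show "(\<Sum>b\<in>insert a S. \<phi> (card {x \<in> insert a S. (Transposition.transpose a b \<circ> q) x = x})) =
       (real (card S) + 1) *
      ((\<phi> (Suc (?x q)) + real (?x q) * \<phi> (?x q - 1) + (real (card S) - real (?x q)) * \<phi> (?x q)) / (real (card S) + 1))"
      by simp
  qed
  also have "\<dots> = (real (card S) + 1) * (fact (card S) * fix_mean (card S)
      (\<lambda>x. (\<phi> (Suc x) + real x * \<phi> (x - 1) + (real (card S) - real x) * \<phi> x) / (real (card S) + 1)))"
    by (subst insert.IH[symmetric]) (simp only: sum_distrib_left)
  finally show ?case
    using insert.hyps by (simp add: algebra_simps)
qed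

lemma fix_mean_mono:
  assumes "\<And>x. x \<le> N \<Longrightarrow> \<phi> x \<le> \<theta> x"
  shows "fix_mean N \<phi> \<le> fix_mean N \<theta>"
  using assms
proof (induction N arbitrary: \<phi> \<theta>)
  case (Suc N)
  show ?case
    unfolding fix_mean.simps
    by (rule Suc.IH) (intro divide_right_mono add_mono mult_left_mono Suc.prems; simp)
qed simp

lemma fix_mean_cong:
  assumes "\<And>x. x \<le> N \<Longrightarrow> \<phi> x = \<theta> x"
  shows "fix_mean N \<phi> = fix_mean N \<theta>"
  by (intro antisym fix_mean_mono) (use assms in auto)

lemma fix_mean_linear:
  "fix_mean N (\<lambda>x. a * \<phi> x + b * \<theta> x) = a * fix_mean N \<phi> + b * fix_mean N \<theta>"
proof (induction N arbitrary: \<phi> \<theta>)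
  case (Suc N)
  show ?case
    unfolding fix_mean.simps Suc.IH[symmetric]
    by (rule arg_cong[where f = "fix_mean N"]) (simp add: fun_eq_iff add_divide_distrib [symmetric] algebra_simps)
qed simp

lemma fix_mean_const: "fix_mean N (\<lambda>x. c) = c"
proof (induction N)
  case (Suc N)
  have "(c + real x * c + (real N - real x) * c) / (real N + 1) = c" for x
    by (simp add: field_simps)
  with Suc show ?case by simp
qed simp

lemma fix_mean_id:
  assumes "N \<ge> 1" shows "fix_mean N real = 1"
  using assms
proof (induction N rule: dec_induct)
  case base
  then show ?case by (simp add: fix_mean.simps)
next
  case (step N)
  have "fix_mean (Suc N) real = fix_mean N (\<lambda>x. (real N / (real N + 1)) * real x + (1 / (real N + 1)) * 1)"
    unfolding fix_mean.simps
  proof (intro fix_mean_cong)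
    fix x
    show "(real (Suc x) + real x * real (x - 1) + (real N - real x) * real x) / (real N + 1) =
         real N / (real N + 1) * real x + 1 / (real N + 1) * 1"
      by (cases x) (simp_all add: field_simps)
  qed
  also have "\<dots> = 1"
    by (subst fix_mean_linear) (simp add: step.IH fix_mean_const field_simps)
  finally show ?case .
qed

text \<open>One insertion turns the square into
  \<open>((N - 1) * x\<^sup>2 + 3 * x + 1) / (N + 1)\<close>; with mean 1, the value 2 reproduces
  itself from \<open>N = 2\<close> on.\<close>

lemma fix_mean_square:
  assumes "N \<ge> 2" shows "fix_mean N (\<lambda>x. (real x)\<^sup>2) = 2"
  using assms
proof (induction N rule: dec_induct)
  case base
  then show ?case by (simp add: fix_mean.simps numeral_2_eq_2)
next
  case (step N)
  have "fix_mean (Suc N) (\<lambda>x. (real x)\<^sup>2) = fix_mean N (\<lambda>x. ((real N - 1) / (real N + 1)) * (real x)\<^sup>2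
      + (1 / (real N + 1)) * (3 * real x + 1 * 1))"
    unfolding fix_mean.simps
  proof (intro fix_mean_cong)
    fix x
    show "((real (Suc x))\<^sup>2 + real x * (real (x - 1))\<^sup>2 + (real N - real x) * (real x)\<^sup>2) / (real N + 1) =
         (real N - 1) / (real N + 1) * (real x)\<^sup>2 + 1 / (real N + 1) * (3 * real x + 1 * 1)"
      by (cases x) (simp_all add: add_divide_distrib [symmetric] power2_eq_square algebra_simps)
  qed
  also have "\<dots> = 2"
    unfolding fix_mean_linear using step by (simp add: fix_mean_const fix_mean_id add_divide_distrib [symmetric] divide_eq_eq)
  finally show ?case .
qed

text \<open>Removing a point from the cycle containing it destroys at most that one fixed point.\<close>

lemma fix_mean_Suc_le:
  assumes "\<And>x. x \<le> N \<Longrightarrow> \<phi> x \<le> \<phi> (Suc x)"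
  shows "fix_mean (Suc N) \<phi> \<le> fix_mean N (\<lambda>x. \<phi> (Suc x))"
  unfolding fix_mean.simps
proof (rule fix_mean_mono)
  fix x assume x: "x \<le> N"
  have "\<phi> (x - 1) \<le> \<phi> (Suc x)" if "x > 0"
    using assms[of "x - 1"] assms[of x] x that by (cases x) auto
  then have "real x * \<phi> (x - 1) \<le> real x * \<phi> (Suc x)"
    by (cases x) (auto intro: mult_left_mono)
  moreover have "(real N - real x) * \<phi> x \<le> (real N - real x) * \<phi> (Suc x)"
    using assms[OF x] x by (intro mult_left_mono) auto
  ultimately show "(\<phi> (Suc x) + real x * \<phi> (x - 1) + (real N - real x) * \<phi> x) / (real N + 1) \<le> \<phi> (Suc x)"
    by (simp add: field_simps)
qed

section \<open>Occupied boxes\<close>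

text \<open>The parameters of \<open>occ_mean\<close> are the number of boxes, the number of balls still to be
  thrown and the number of boxes already occupied.\<close>

fun occ_mean :: "nat \<Rightarrow> nat \<Rightarrow> (nat \<Rightarrow> real) \<Rightarrow> nat \<Rightarrow> real" where
  "occ_mean M 0 \<psi> s = \<psi> s"
| "occ_mean M (Suc n) \<psi> s =
     (real s * occ_mean M n \<psi> s + (real M - real s) * occ_mean M n \<psi> (Suc s)) / real M"

lemma sum_PiE_insert:
  assumes "finite A" "x \<notin> A" "finite F"
  shows "(\<Sum>v\<in>PiE (insert x A) (\<lambda>_. F). g v) = (\<Sum>y\<in>F. \<Sum>v\<in>PiE A (\<lambda>_. F). g (v(x := y)))"
proof -
  have "(\<Sum>v\<in>PiE (insert x A) (\<lambda>_. F). g v) = (\<Sum>(y, v)\<in>F \<times> PiE A (\<lambda>_. F). g (v(x := y)))"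
    unfolding PiE_insert_eq
    by (subst sum.reindex) (use inj_combinator[OF assms(2), of "\<lambda>_. F"] in \<open>simp_all add: case_prod_unfold\<close>)
  then show ?thesis by (simp add: sum.cartesian_product)
qed

text \<open>The set A holds the boxes occupied beforehand. The coordinate of largest index is the
  next ball: its value y is uniform in F and joins A.\<close>

lemma sum_PiE_card_image:
  assumes "finite F" "F \<noteq> {}" "A \<subseteq> F"
  shows "(\<Sum>v\<in>PiE {..<n} (\<lambda>_. F). \<psi> (card (A \<union> v ` {..<n}))) =
    real (card F) ^ n * occ_mean (card F) n \<psi> (card A)"
  using assms
proof (induction n arbitrary: A)
  case (Suc n)
  let ?m = "occ_mean (card F) n \<psi>"
  have "finite A" using Suc.prems finite_subset by auto
  have "(\<Sum>v\<in>PiE {..<Suc n} (\<lambda>_. F). \<psi> (card (A \<union> v ` {..<Suc n}))) =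
      (\<Sum>y\<in>F. \<Sum>v\<in>PiE {..<n} (\<lambda>_. F). \<psi> (card (insert y A \<union> v ` {..<n})))"
    unfolding lessThan_Suc using Suc.prems
    by (subst sum_PiE_insert) (auto intro!: sum.cong arg_cong[where f = "\<lambda>S. \<psi> (card S)"])
  also have "\<dots> = (\<Sum>y\<in>F. real (card F) ^ n * ?m (card (insert y A)))"
    using Suc.prems by (intro sum.cong Suc.IH) auto
  also have "\<dots> = real (card F) ^ n * (\<Sum>y\<in>F. if y \<in> A then ?m (card A) else ?m (Suc (card A)))"
    unfolding sum_distrib_left using \<open>finite A\<close>
    by (intro sum.cong) (auto simp: insert_absorb)
  also have "(\<Sum>y\<in>F. if y \<in> A then ?m (card A) else ?m (Suc (card A))) =
      real (card A) * ?m (card A) + real (card (F - A)) * ?m (Suc (card A))"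
    using Suc.prems by (simp add: sum.If_cases Int_absorb1 Diff_eq)
  also have "real (card (F - A)) = real (card F) - real (card A)"
    using Suc.prems \<open>finite A\<close> by (simp add: card_Diff_subset card_mono of_nat_diff)
  finally show ?case
    using Suc.prems by (simp add: card_gt_0_iff)
qed simp

lemma occ_mean_cong:
  assumes "\<And>j. s \<le> j \<Longrightarrow> j \<le> s + n \<Longrightarrow> \<psi> j = \<psi>' j"
  shows "occ_mean M n \<psi> s = occ_mean M n \<psi>' s"
  using assms
proof (induction n arbitrary: s)
  case (Suc n)
  have "occ_mean M n \<psi> s = occ_mean M n \<psi>' s" "occ_mean M n \<psi> (Suc s) = occ_mean M n \<psi>' (Suc s)"
    by (intro Suc.IH Suc.prems; simp)+
  then show ?case by simp
qed simp

text \<open>From no occupied box the first ball always occupies one, so \<open>\<psi> 0\<close> does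
  not enter.\<close>

lemma occ_mean_cong_pos:
  assumes "\<And>j. 1 \<le> j \<Longrightarrow> j \<le> n \<Longrightarrow> \<psi> j = \<psi>' j" "n \<ge> 1"
  shows "occ_mean M n \<psi> 0 = occ_mean M n \<psi>' 0"
proof -
  obtain n' where n: "n = Suc n'" using assms by (cases n) auto
  have "occ_mean M n' \<psi> 1 = occ_mean M n' \<psi>' 1"
    by (rule occ_mean_cong) (use assms n in auto)
  then show ?thesis by (simp add: n)
qed

lemma occ_mean_linear:
  "occ_mean M n (\<lambda>j. a * \<phi> j + b * \<psi> j) s = a * occ_mean M n \<phi> s + b * occ_mean M n \<psi> s"
proof (induction n arbitrary: s)
  case (Suc n)
  show ?case
    unfolding occ_mean.simps Suc.IH by (simp add: add_divide_distrib [symmetric] algebra_simps)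
qed simp

lemma occ_mean_const: "M > 0 \<Longrightarrow> occ_mean M n (\<lambda>j. c) s = c"
  by (induction n arbitrary: s) (simp_all add: field_simps)

text \<open>After one ball the difference is a combination of the differences at s and at
  \<open>Suc s\<close>, with nonnegative weights proportional to s and
  \<open>M - Suc s\<close>.\<close>

lemma occ_mean_mono_occupied:
  assumes "mono \<phi>" "s < M"
  shows "occ_mean M n \<phi> s \<le> occ_mean M n \<phi> (Suc s)"
  using assms(2)
proof (induction n arbitrary: s)
  case 0
  then show ?case using assms(1) by (simp add: monoD)
next
  case (Suc n)
  let ?V = "occ_mean M n \<phi>"
  have M: "real M > 0" using Suc.prems by simp
  have "real s * ?V s \<le> real s * ?V (Suc s)"
    using Suc by (intro mult_left_mono) auto
  moreover have "(real M - real (Suc s)) * ?V (Suc s) \<le> (real M - real (Suc s)) * ?V (Suc (Suc s))"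
  \<comment> \<open>At the boundary the induction hypothesis does not cover \<open>Suc s\<close>,
    but the weight is 0 there.\<close>
  proof (cases "Suc s = M")
    case False
    then show ?thesis using Suc by (intro mult_left_mono) auto
  qed simp
  ultimately show ?case
    using M by (simp add: divide_right_mono algebra_simps)
qed

text \<open>With an extra box the ball hits an occupied box with probability
  \<open>s / (M + 1)\<close> instead of \<open>s / M\<close>, and by monotonicity in s an empty box
  is the better one to hit.\<close>

lemma occ_mean_mono_boxes:
  assumes "mono \<phi>" "s \<le> M" "M > 0"
  shows "occ_mean M n \<phi> s \<le> occ_mean (Suc M) n \<phi> s"
  using assms(2)
proof (induction n arbitrary: s)
  case (Suc n)
  let ?V = "occ_mean M n \<phi>" and ?W = "occ_mean (Suc M) n \<phi>"
  have M: "real M > 0" using assms by simp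
  have VW: "?V s \<le> ?W s" using Suc by simp
  have W: "?W s \<le> ?W (Suc s)"
    using Suc.prems by (intro occ_mean_mono_occupied assms) auto
  have VW': "(real M - real s) * ?V (Suc s) \<le> (real M - real s) * ?W (Suc s)"
  proof (cases "s = M")
    case False
    then show ?thesis using Suc by (intro mult_left_mono) auto
  qed simp
  have "(real s * ?V s + (real M - real s) * ?V (Suc s)) / real M \<le>
      (real s * ?W s + (real M - real s) * ?W (Suc s)) / real M"
    using M VW VW' by (intro divide_right_mono add_mono mult_left_mono[OF VW]) auto
  also have "\<dots> = ?W (Suc s) - (real s / real M) * (?W (Suc s) - ?W s)"
    using M by (simp add: field_simps)
  also have "\<dots> \<le> ?W (Suc s) - (real s / real (Suc M)) * (?W (Suc s) - ?W s)"
    using M W by (intro diff_left_mono mult_right_mono divide_left_mono) auto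
  also have "\<dots> = (real s * ?W s + (real (Suc M) - real s) * ?W (Suc s)) / real (Suc M)"
    by (simp add: field_simps)
  finally show ?case by simp
qed simp

text \<open>A given empty box is missed by all n balls with probability
  \<open>(1 - 1 / M) ^ n\<close>.\<close>

lemma occ_mean_empty_boxes:
  assumes "M > 0"
  shows "occ_mean M n (\<lambda>j. real M - real j) s = (real M - real s) * (1 - 1 / real M) ^ n"
  using assms
proof (induction n arbitrary: s)
  case (Suc n)
  let ?q = "(1 - 1 / real M) ^ n" and ?z = "real M - real s"
  have "occ_mean M (Suc n) (\<lambda>j. real M - real j) s =
     (real s * (?z * ?q) + ?z * ((?z - 1) * ?q)) / real M"
    unfolding occ_mean.simps Suc.IH[OF Suc.prems] by (simp add: algebra_simps)
  also have "\<dots> = ?z * ?q * ((real s + ?z - 1) / real M)"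
    by (simp add: algebra_simps add_divide_distrib diff_divide_distrib)
  also have "(real s + ?z - 1) / real M = 1 - 1 / real M"
    using Suc.prems by (simp add: field_simps)
  finally show ?case by simp
qed simp

text \<open>The second factorial moment of the number of empty boxes: a given pair of them is missed
  by all n balls with probability \<open>(1 - 2 / M) ^ n\<close>.\<close>

lemma occ_mean_empty_box_pairs:
  assumes "M > 0"
  shows "occ_mean M n (\<lambda>j. (real M - real j) * (real M - real j - 1)) s =
    (real M - real s) * (real M - real s - 1) * (1 - 2 / real M) ^ n"
  using assms
proof (induction n arbitrary: s)
  case (Suc n)
  let ?q = "(1 - 2 / real M) ^ n" and ?z = "real M - real s"
  have "occ_mean M (Suc n) (\<lambda>j. (real M - real j) * (real M - real j - 1)) s =
     (real s * (?z * (?z - 1) * ?q) + ?z * ((?z - 1) * (?z - 2) * ?q)) / real M"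
    unfolding occ_mean.simps Suc.IH[OF Suc.prems] by (simp add: algebra_simps)
  also have "\<dots> = ?z * (?z - 1) * ?q * ((real s + ?z - 2) / real M)"
    by (simp add: algebra_simps add_divide_distrib diff_divide_distrib)
  also have "(real s + ?z - 2) / real M = 1 - 2 / real M"
    using Suc.prems by (simp add: field_simps)
  finally show ?case by simp
qed simp

section \<open>A quadratic test function\<close>

text \<open>Starting from 0 with \<open>n \<ge> 1\<close> balls, only counts between 1 and n result,
  so \<open>\<phi>\<close> can be clamped to that range, which makes it monotone everywhere.\<close>

lemma occ_mean_mono_boxes_pos:
  assumes "\<And>j. 1 \<le> j \<Longrightarrow> j < n \<Longrightarrow> \<phi> j \<le> \<phi> (Suc j)" "n \<ge> 1" "M > 0"
  shows "occ_mean M n \<phi> 0 \<le> occ_mean (Suc M) n \<phi> 0"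
proof -
  define \<phi>' where "\<phi>' j = \<phi> (max 1 (min j n))" for j
  have "\<phi>' j \<le> \<phi>' (Suc j)" for j
    using assms(1)[of j] assms(2) by (cases "j = 0"; cases "j < n") (auto simp: \<phi>'_def min_def max_def)
  then have "mono \<phi>'" by (rule mono_iff_le_Suc[THEN iffD2, rule_format])
  then have "occ_mean M n \<phi>' 0 \<le> occ_mean (Suc M) n \<phi>' 0"
    using assms by (intro occ_mean_mono_boxes) auto
  moreover have "occ_mean K n \<phi>' 0 = occ_mean K n \<phi> 0" for K
    using assms(2) by (intro occ_mean_cong_pos) (auto simp: \<phi>'_def)
  ultimately show ?thesis by simp
qed

lemma occ_mean_card:
  assumes "M > 0"
  shows "occ_mean M n real 0 = real M - real M * (1 - 1 / real M) ^ n"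
proof -
  have "occ_mean M n real 0 = occ_mean M n (\<lambda>j. real M * 1 + (-1) * (real M - real j)) 0"
    by (intro occ_mean_cong) simp
  also have "\<dots> = real M - real M * (1 - 1 / real M) ^ n"
    unfolding occ_mean_linear using assms by (simp add: occ_mean_const occ_mean_empty_boxes)
  finally show ?thesis .
qed

definition quad :: "nat \<Rightarrow> nat \<Rightarrow> real" where
  "quad k j = 3 * real k * real j - (real j)\<^sup>2"

lemma quad_Suc: "quad k (Suc j) - quad k j = 3 * real k - 2 * real j - 1"
  by (simp add: quad_def power2_eq_square algebra_simps)

text \<open>In terms of the number \<open>z = M - j\<close> of empty boxes, \<open>quad k j\<close>
  is \<open>quad k M - (3 * k - 2 * M + 1) * z - z * (z - 1)\<close>, so the first two factorial
  moments of z suffice.\<close>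

lemma occ_mean_quad:
  assumes "M > 0"
  shows "occ_mean M n (quad k) 0 = quad k M -
    ((3 * real k - 2 * real M + 1) * (real M * (1 - 1 / real M) ^ n) +
     real M * (real M - 1) * (1 - 2 / real M) ^ n)"
proof -
  let ?c = "3 * real k - 2 * real M + 1"
  have "occ_mean M n (quad k) 0 = occ_mean M n (\<lambda>j. quad k M * 1 +
      (-1) * (?c * (real M - real j) + 1 * ((real M - real j) * (real M - real j - 1)))) 0"
    by (intro occ_mean_cong) (simp add: quad_def power2_eq_square algebra_simps)
  also have "\<dots> = quad k M - (?c * (real M * (1 - 1 / real M) ^ n) +
     real M * (real M - 1) * (1 - 2 / real M) ^ n)"
    unfolding occ_mean_linear using assms
    by (simp add: occ_mean_const occ_mean_empty_boxes occ_mean_empty_box_pairs)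
  finally show ?thesis .
qed

text \<open>The quotient of the two bases is \<open>1 + 1 / (M\<^sup>2 - 1)\<close>, and Bernoulli's
  inequality bounds its nth power from below.\<close>

lemma pow_ratio_bernoulli:
  assumes "M \<ge> 2"
  shows "(1 - 1 / real M) ^ n * (1 + real n / ((real M)\<^sup>2 - 1)) \<le> (1 - 1 / real (Suc M)) ^ n"
proof -
  have M2: "(real M)\<^sup>2 > 1" using assms by (simp add: power2_eq_square less_1_mult)
  have "1 + real n * (1 / ((real M)\<^sup>2 - 1)) \<le> (1 + 1 / ((real M)\<^sup>2 - 1)) ^ n"
    using M2 by (intro Bernoulli_inequality) (simp add: order_trans[of _ 0])
  then have "(1 - 1 / real M) ^ n * (1 + real n / ((real M)\<^sup>2 - 1)) \<le>
      (1 - 1 / real M) ^ n * (1 + 1 / ((real M)\<^sup>2 - 1)) ^ n"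
    using assms by (intro mult_left_mono) auto
  also have "\<dots> = ((1 - 1 / real M) * (1 + 1 / ((real M)\<^sup>2 - 1))) ^ n"
    by (simp add: power_mult_distrib)
  also have "(1 - 1 / real M) * (1 + 1 / ((real M)\<^sup>2 - 1)) = 1 - 1 / real (Suc M)"
  proof -
    have "(real M)\<^sup>2 - 1 = (real M - 1) * (real M + 1)" by (simp add: power2_eq_square algebra_simps)
    moreover have "real M - 1 > 0" using assms by simp
    ultimately show ?thesis by (simp add: divide_simps) (simp add: algebra_simps)
  qed
  finally show ?thesis .
qed

text \<open>With \<open>M = j + 1\<close> the right side is the reciprocal of
  \<open>(1 + 1 / j) ^ j\<close>, which is at most e and so at most 3.\<close>

lemma one_third_le_pow:
  assumes "M \<ge> 2"
  shows "1 / 3 \<le> (1 - 1 / real M) ^ (M - 1)"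
proof -
  obtain j where M: "M = Suc j" and j: "j \<ge> 1" using assms by (cases M) auto
  have "(1 + 1 / real j) ^ j \<le> exp (1 / real j) ^ j"
    by (intro power_mono) auto
  also have "\<dots> = exp 1"
    using j by (simp flip: exp_of_nat_mult)
  also have "\<dots> \<le> 3" by (rule exp_le)
  finally have "1 / 3 \<le> 1 / (1 + 1 / real j) ^ j"
    using j by (intro divide_left_mono) (auto intro!: mult_pos_pos zero_less_power add_pos_nonneg)
  also have "\<dots> = (1 - 1 / real M) ^ (M - 1)"
    using j by (simp add: M flip: power_one_over) (simp add: field_simps)
  finally show ?thesis .
qed

text \<open>The right side \<open>\<theta> n\<close>, the gain in the mean number of empty boxes
  from one more box, decreases in n, so \<open>n = M\<close> is the worst case. There Bernoulli's
  bound simplifies to \<open>p * (2 - 1 / M)\<close> with \<open>p \<ge> 1 / 3\<close>.\<close>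

lemma empty_boxes_step_ge:
  assumes "M \<ge> 2" "n \<le> M"
  shows "2 / 3 * (1 - 1 / real M) \<le>
    real (Suc M) * (1 - 1 / real (Suc M)) ^ n - real M * (1 - 1 / real M) ^ n"
proof -
  define \<theta> where "\<theta> n = real (Suc M) * (1 - 1 / real (Suc M)) ^ n - real M * (1 - 1 / real M) ^ n" for n
  have "\<theta> (Suc n) \<le> \<theta> n" for n
  proof -
    have "real (Suc M) * (1 - 1 / real (Suc M)) = real M" "real M * (1 - 1 / real M) = real M - 1"
      using assms by (simp_all add: field_simps)
    then have "\<theta> (Suc n) = real M * (1 - 1 / real (Suc M)) ^ n - (real M - 1) * (1 - 1 / real M) ^ n"
      by (simp add: \<theta>_def flip: mult.assoc)
    then have "\<theta> n - \<theta> (Suc n) = (1 - 1 / real (Suc M)) ^ n - (1 - 1 / real M) ^ n"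
      by (simp add: \<theta>_def algebra_simps)
    also have "\<dots> \<ge> 0"
      using assms by (simp add: power_mono frac_le)
    finally show ?thesis by simp
  qed
  then have "\<theta> M \<le> \<theta> n"
    using assms(2) by (rule lift_Suc_antimono_le)
  moreover have "2 / 3 * (1 - 1 / real M) \<le> \<theta> M"
  proof -
    define p where "p = (1 - 1 / real M) ^ (M - 1)"
    have pM: "(1 - 1 / real M) ^ M = (1 - 1 / real M) * p"
      using assms unfolding p_def by (metis Suc_diff_1 power_Suc less_le_trans zero_less_numeral)
    have "2 / 3 * (1 - 1 / real M) \<le> (1 / 3) * (2 - 1 / real M)"
      using assms by (simp add: field_simps)
    also have "\<dots> \<le> p * (2 - 1 / real M)"
      using one_third_le_pow[OF assms(1)] assms(1) unfolding p_def
      by (intro mult_right_mono) (auto simp: field_simps)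
    also have "\<dots> = real (Suc M) * ((1 - 1 / real M) ^ M * (1 + real M / ((real M)\<^sup>2 - 1)))
        - real M * (1 - 1 / real M) ^ M"
    proof -
      have "(real M)\<^sup>2 - 1 = (real M - 1) * (real M + 1)" by (simp add: power2_eq_square algebra_simps)
      moreover have "real M - 1 > 0" using assms by simp
      ultimately show ?thesis unfolding pM by (simp add: divide_simps) (simp add: algebra_simps)
    qed
    also have "\<dots> \<le> \<theta> M"
      unfolding \<theta>_def using pow_ratio_bernoulli[OF assms(1), of M]
      by (intro diff_right_mono mult_left_mono) auto
    finally show ?thesis .
  qed
  ultimately show ?thesis by (simp add: \<theta>_def)
qed

text \<open>Equivalently, the loss \<open>quad k M - occ_mean M n (quad k) 0\<close> does not
  decrease when a box is added. Its pair term grows with M. In the other term the coefficient c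
  falls by 2, which the growth of \<open>M * (1 - 1 / M) ^ n\<close> outweighs for
  \<open>n \<ge> M\<close>.\<close>

lemma occ_mean_quad_step_many_balls:
  assumes "M \<ge> 2" "M \<le> n" "M < k"
  shows "occ_mean (Suc M) n (quad k) 0 - occ_mean M n (quad k) 0 \<le> 3 * real k - 2 * real M - 1"
proof -
  define c where "c = 3 * real k - 2 * real M + 1"
  define p where "p = (1 - 1 / real M) ^ n"
  have p: "p \<ge> 0" using assms by (simp add: p_def)
  have kM: "real k \<ge> real M + 1" using assms by simp
  have c: "c \<ge> real M + 2" using kM by (simp add: c_def)
  have pairs: "real M * (real M - 1) * (1 - 2 / real M) ^ n \<le>
      real (Suc M) * (real (Suc M) - 1) * (1 - 2 / real (Suc M)) ^ n"
    using assms by (intro mult_mono power_mono diff_left_mono frac_le) auto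
  \<comment> \<open>The bound \<open>c * M \<le> (c - 2) * (M + 2)\<close> amounts to
    \<open>c \<ge> M + 2\<close>. The factor \<open>M + 2\<close> is then reached from
    \<open>M + 1\<close> by Bernoulli's bound, because \<open>n \<ge> M\<close>.\<close>
  have "c * (real M * p) \<le> (c - 2) * (real M + 2) * p"
  proof -
    have "c * real M \<le> (c - 2) * (real M + 2)" using c by (simp add: algebra_simps)
    from mult_right_mono[OF this p] show ?thesis by (simp add: mult.assoc)
  qed
  also have "\<dots> \<le> (c - 2) * (real (Suc M) * (p * (1 + real n / ((real M)\<^sup>2 - 1))))"
  proof -
    have eq: "(real M)\<^sup>2 - 1 = (real M - 1) * (real M + 1)" by (simp add: power2_eq_square algebra_simps)
    have M1: "real M - 1 > 0" using assms by simp
    have "1 \<le> real n / (real M - 1)" using M1 assms by simp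
    moreover have "real (Suc M) * (1 + real n / ((real M)\<^sup>2 - 1)) = real M + 1 + real n / (real M - 1)"
      unfolding eq using M1 by (simp add: divide_simps) (simp add: algebra_simps)
    ultimately have "real M + 2 \<le> real (Suc M) * (1 + real n / ((real M)\<^sup>2 - 1))" by simp
    moreover have "(c - 2) * p \<ge> 0" using c p by simp
    ultimately have "(c - 2) * p * (real M + 2) \<le> (c - 2) * p * (real (Suc M) * (1 + real n / ((real M)\<^sup>2 - 1)))"
      by (rule mult_left_mono)
    then show ?thesis by (simp only: mult_ac)
  qed
  also have "\<dots> \<le> (c - 2) * (real (Suc M) * (1 - 1 / real (Suc M)) ^ n)"
    using pow_ratio_bernoulli[OF assms(1), of n] c unfolding p_def
    by (intro mult_left_mono) auto
  finally have "c * (real M * p) \<le> (c - 2) * (real (Suc M) * (1 - 1 / real (Suc M)) ^ n)" .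
  moreover have "3 * real k - 2 * real (Suc M) + 1 = c - 2" by (simp add: c_def)
  then have "occ_mean (Suc M) n (quad k) 0 = quad k (Suc M) -
      ((c - 2) * (real (Suc M) * (1 - 1 / real (Suc M)) ^ n) +
       real (Suc M) * (real (Suc M) - 1) * (1 - 2 / real (Suc M)) ^ n)"
    by (simp only: occ_mean_quad[OF zero_less_Suc])
  moreover have "occ_mean M n (quad k) 0 = quad k M -
      (c * (real M * p) + real M * (real M - 1) * (1 - 2 / real M) ^ n)"
    using assms by (simp add: occ_mean_quad c_def p_def)
  ultimately show ?thesis
    using pairs quad_Suc[of k M] by linarith
qed

text \<open>The largest increment of \<open>quad k\<close> on positive counts is
  \<open>3 * k - 3\<close>, so \<open>(3 * k - 3) * j - quad k j\<close> is nondecreasing there, and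
  an extra box raises the mean of \<open>quad k\<close> by at most \<open>3 * k - 3\<close> times
  the rise of the mean number of occupied boxes.\<close>

lemma occ_mean_quad_step_few_balls:
  assumes "M \<ge> 2" "1 \<le> n" "n \<le> M" "M < k"
  shows "occ_mean (Suc M) n (quad k) 0 - occ_mean M n (quad k) 0 \<le> 3 * real k - 2 * real M - 1"
proof -
  let ?w = "3 * real k - 3"
  have "occ_mean M n (\<lambda>j. ?w * real j + (-1) * quad k j) 0 \<le>
      occ_mean (Suc M) n (\<lambda>j. ?w * real j + (-1) * quad k j) 0"
  proof (rule occ_mean_mono_boxes_pos)
    fix j :: nat assume "1 \<le> j"
    then show "?w * real j + (-1) * quad k j \<le> ?w * real (Suc j) + (-1) * quad k (Suc j)"
      using quad_Suc[of k j] by (simp add: algebra_simps)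
  qed (use assms in auto)
  then have "occ_mean (Suc M) n (quad k) 0 - occ_mean M n (quad k) 0 \<le>
      ?w * (occ_mean (Suc M) n real 0 - occ_mean M n real 0)"
    unfolding occ_mean_linear by (simp add: algebra_simps)
  also have "occ_mean (Suc M) n real 0 - occ_mean M n real 0 =
      1 - (real (Suc M) * (1 - 1 / real (Suc M)) ^ n - real M * (1 - 1 / real M) ^ n)"
    using assms occ_mean_card[of "Suc M" n] occ_mean_card[of M n] by simp
  also have "?w * \<dots> \<le> ?w * (1 - 2 / 3 * (1 - 1 / real M))"
    using empty_boxes_step_ge[OF assms(1,3)] assms by (intro mult_left_mono diff_left_mono) auto
  \<comment> \<open>The left side is \<open>(k - 1) * (1 + 2 / M)\<close>; clearing denominators
    reduces the claim to \<open>(M + 1) * (M - 1) \<le> k * (M - 1)\<close>.\<close>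
  also have "\<dots> \<le> 3 * real k - 2 * real M - 1"
  proof -
    have "real k \<ge> real M + 1" "real M > 0" using assms by auto
    then have "real k * (real M - 1) \<ge> (real M + 1) * (real M - 1)"
      using assms by (intro mult_right_mono) auto
    then show ?thesis using \<open>real M > 0\<close> by (simp add: field_simps)
  qed
  finally show ?thesis .
qed

lemma occ_mean_quad_step:
  assumes "1 \<le> n" "1 \<le> M" "M < k"
  shows "occ_mean (Suc M) n (quad k) 0 - occ_mean M n (quad k) 0 \<le> 3 * real k - 2 * real M - 1"
proof (cases "M = 1")
  \<comment> \<open>With one box the loss is 0. With two boxes the pair term vanishes, as
    \<open>1 - 2 / 2 = 0\<close> and \<open>n \<ge> 1\<close>, and the loss is
    \<open>(3 * k - 3) * (2 * (1 / 2) ^ n)\<close>.\<close>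
  case True
  have "0 \<le> (3 * real k - 3) * (2 * (1 / 2) ^ n)" using assms by simp
  with True assms show ?thesis
    by (simp add: occ_mean_quad power_0_left) (simp add: quad_def)
next
  case False
  then show ?thesis
    using assms occ_mean_quad_step_few_balls[of M n k] occ_mean_quad_step_many_balls[of M n k] by linarith
qed

section \<open>The block count\<close>

definition size_op :: "nat \<Rightarrow> nat \<Rightarrow> (nat \<Rightarrow> real) \<Rightarrow> nat \<Rightarrow> real" where
  "size_op k n \<psi> m = fix_mean (k - m) (\<lambda>x. occ_mean (m + x) n \<psi> 0)"

lemma size_op_linear:
  "size_op k n (\<lambda>j. a * \<phi> j + b * \<psi> j) m = a * size_op k n \<phi> m + b * size_op k n \<psi> m"
  unfolding size_op_def occ_mean_linear fix_mean_linear ..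

text \<open>Declaring one more value used trades a random point for a certain fixed point, as in
  \<open>fix_mean_Suc_le\<close>.\<close>

lemma fix_mean_shift_le:
  assumes "\<And>M. 1 \<le> M \<Longrightarrow> M < k \<Longrightarrow> U M \<le> U (Suc M)" "1 \<le> m" "m < k"
  shows "fix_mean (k - m) (\<lambda>x. U (m + x)) \<le> fix_mean (k - Suc m) (\<lambda>x. U (Suc m + x))"
proof -
  have "k - m = Suc (k - Suc m)" using assms by simp
  then show ?thesis
    using fix_mean_Suc_le[of "k - Suc m" "\<lambda>x. U (m + x)"] assms by simp
qed

lemma size_op_mono:
  assumes "\<And>j. 1 \<le> j \<Longrightarrow> j < n \<Longrightarrow> \<phi> j \<le> \<phi> (Suc j)" "1 \<le> m" "m < k" "1 \<le> n"
  shows "size_op k n \<phi> m \<le> size_op k n \<phi> (Suc m)"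
  unfolding size_op_def
  by (intro fix_mean_shift_le occ_mean_mono_boxes_pos assms) auto

lemma size_op_quad_step:
  assumes "1 \<le> m" "m < n" "n \<le> k"
  shows "size_op k n (quad k) (Suc m) - size_op k n (quad k) m \<le>
    (1 - 2 / (3 * real k - 3)) * (3 * real k - 2 * real m - 1)"
proof -
  define U where "U M = occ_mean M n (quad k) 0" for M
  have op: "size_op k n (quad k) m = fix_mean (k - m) (\<lambda>x. U (m + x))" for m
    by (simp add: size_op_def U_def)
  have U_step: "U (Suc M) - U M \<le> 3 * real k - 2 * real M - 1" if "1 \<le> M" "M < k" for M
    using occ_mean_quad_step[of n M k] that assms unfolding U_def by simp
  have k: "real k \<ge> 2" using assms by simp
  consider "k = Suc m" | "k = Suc (Suc m)" | "k - Suc m \<ge> 2" by (use assms in linarith)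
  then show ?thesis
  proof cases
    \<comment> \<open>A permutation of at most one point is the identity, so both block counts lead
      to k boxes and the difference is 0.\<close>
    case 1
    have "real k - 1 = real m" using 1 by simp
    moreover have "(1 - 2 / (3 * real k - 3)) \<ge> 0" using k by (simp add: field_simps)
    ultimately show ?thesis unfolding op using 1 k by (simp add: mult_nonneg_nonneg)
  next
    \<comment> \<open>A permutation of two points fixes both or none, so m leads to k or m boxes
      with probability 1/2 each, and \<open>Suc m\<close> always to k. The bounds on two increments
      of U add up to \<open>2 * k + 4\<close>, which suffices from \<open>k = 9\<close> on; the
      smaller k are computed.\<close>
    case 2
    define X where "X = (1 - 2 / (3 * real k - 3)) * (real k + 3)"
    have "U k - U m \<le> 2 * X"
    proof (cases "k \<ge> 9")
      case True
      have "U k - U m \<le> 2 * real k + 4"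
        using U_step[of m] U_step[of "Suc m"] 2 assms by simp
      also have "\<dots> \<le> 2 * ((1 - 2 / (3 * real k - 3)) * (real k + 3))"
        using True by (simp add: field_simps)
      finally show ?thesis unfolding X_def .
    next
      case False
      then have "k \<in> {3,4,5,6,7,8}" "n \<in> {k - 1, k}" "m = k - 2" using 2 assms by auto
      then show ?thesis
        by (elim insertE; simp add: X_def U_def occ_mean_quad quad_def field_simps)
    qed
    moreover have "size_op k n (quad k) (Suc m) = U k" "size_op k n (quad k) m = (U m + U k) / 2"
      unfolding op using 2 by (simp_all add: numeral_2_eq_2)
    ultimately have "size_op k n (quad k) (Suc m) - size_op k n (quad k) m \<le> X" by (simp add: diff_divide_distrib add_divide_distrib)
    moreover have "(1 - 2 / (3 * real k - 3)) * (3 * real k - 2 * real m - 1) = X"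
      using 2 by (simp add: X_def)
    ultimately show ?thesis by (simp only:)
  next
    case 3
    \<comment> \<open>The loss L caused by throwing the balls is nondecreasing, so it can only lower
      the increment; the rest is the mean of \<open>quad k\<close> at \<open>m + x\<close>, which is
      explicit.\<close>
    define L where "L M = quad k M - U M" for M
    have L_mono: "L M \<le> L (Suc M)" if "1 \<le> M" "M < k" for M
      using U_step[OF that] quad_Suc[of k M] by (simp add: L_def)
    have split: "fix_mean N (\<lambda>x. U (j + x)) = quad k j + (3 * real k - 2 * real j) - 2 - fix_mean N (\<lambda>x. L (j + x))"
      if "N \<ge> 2" for N j
    proof -
      have "fix_mean N (\<lambda>x. U (j + x)) = fix_mean N (\<lambda>x. 1 * (quad k j * 1 +
          1 * ((3 * real k - 2 * real j) * real x + (-1) * (real x)\<^sup>2)) + (-1) * L (j + x))"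
        by (intro fix_mean_cong) (simp add: L_def quad_def power2_eq_square algebra_simps)
      also have "\<dots> = quad k j + (3 * real k - 2 * real j) - 2 - fix_mean N (\<lambda>x. L (j + x))"
        unfolding fix_mean_linear using that by (simp add: fix_mean_const fix_mean_id fix_mean_square)
      finally show ?thesis .
    qed
    have "size_op k n (quad k) (Suc m) - size_op k n (quad k) m \<le> 3 * real k - 2 * real m - 3"
      unfolding op using split[of "k - m" m] split[of "k - Suc m" "Suc m"] 3 quad_Suc[of k m]
        fix_mean_shift_le[of k L m] L_mono assms by simp
    \<comment> \<open>The increment is at most \<open>3 * k - 3\<close> since
      \<open>m \<ge> 1\<close>, so a drop by 2 is at least the proportion
      \<open>2 / (3 * k - 3)\<close> of it.\<close>
    also have "\<dots> \<le> (1 - 2 / (3 * real k - 3)) * (3 * real k - 2 * real m - 1)"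
      using k assms by (simp add: field_simps)
    finally show ?thesis .
  qed
qed

text \<open>The hypothesis on increments says that \<open>c * quad k + \<psi>\<close> and
  \<open>c * quad k - \<psi>\<close> are nondecreasing between 1 and n, and
  \<open>size_op_mono\<close> carries this over to their images.\<close>

lemma size_op_contraction:
  assumes "1 \<le> m" "m < n" "n \<le> k" "c \<ge> 0"
    and "\<And>j. 1 \<le> j \<Longrightarrow> j < n \<Longrightarrow> \<bar>\<psi> (Suc j) - \<psi> j\<bar> \<le> c * (3 * real k - 2 * real j - 1)"
  shows "\<bar>size_op k n \<psi> (Suc m) - size_op k n \<psi> m\<bar> \<le>
    c * (1 - 2 / (3 * real k - 3)) * (3 * real k - 2 * real m - 1)"
proof -
  have "size_op k n (\<lambda>j. c * quad k j + a * \<psi> j) m \<le> size_op k n (\<lambda>j. c * quad k j + a * \<psi> j) (Suc m)"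
    if "a = 1 \<or> a = -1" for a
  proof (rule size_op_mono)
    fix j assume "1 \<le> j" "j < n"
    then have "\<bar>\<psi> (Suc j) - \<psi> j\<bar> \<le> c * (quad k (Suc j) - quad k j)"
      unfolding quad_Suc by (rule assms)
    with that show "c * quad k j + a * \<psi> j \<le> c * quad k (Suc j) + a * \<psi> (Suc j)"
      by (auto simp: algebra_simps)
  qed (use assms in auto)
  from this[of 1] this[of "-1"]
  have "\<bar>size_op k n \<psi> (Suc m) - size_op k n \<psi> m\<bar> \<le> c * (size_op k n (quad k) (Suc m) - size_op k n (quad k) m)"
    unfolding size_op_linear by (simp add: algebra_simps abs_le_iff)
  also have "\<dots> \<le> c * ((1 - 2 / (3 * real k - 3)) * (3 * real k - 2 * real m - 1))"
    using size_op_quad_step[OF assms(1-3)] assms(4) by (rule mult_left_mono)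
  finally show ?thesis by simp
qed

text \<open>The increments of \<open>\<psi> 0\<close> are at most 2, hence at most
  \<open>2 / w\<close> times those of \<open>quad k\<close>. Each step gains the contraction factor,
  and the sum of increments telescopes to at most \<open>quad k n - quad k 1\<close>.\<close>

lemma size_op_iterate_oscillation:
  assumes "\<And>j. 1 \<le> j \<Longrightarrow> j \<le> n \<Longrightarrow> \<bar>\<psi> 0 j\<bar> \<le> 1"
    and "\<And>t j. 1 \<le> j \<Longrightarrow> j \<le> n \<Longrightarrow> \<psi> (Suc t) j = size_op k n (\<psi> t) j"
    and "n \<le> k" "1 \<le> i" "i \<le> j" "j \<le> n"
  shows "\<bar>\<psi> t j - \<psi> t i\<bar> \<le> 2 * (1 - 2 / (3 * real k - 3)) ^ t *
    (real (n - 1) * (3 * real k - 1 - real n) / (3 * real k - 2 * real n + 1))"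
proof -
  \<comment> \<open>The smallest increment of \<open>quad k\<close> below n, attained at
    \<open>j = n - 1\<close>.\<close>
  define w where "w = 3 * real k - 2 * real n + 1"
  define \<rho> where "\<rho> = 1 - 2 / (3 * real k - 3)"
  show ?thesis
  proof (cases "n \<ge> 2")
    case False
    then have "i = 1" "j = 1" "n = 1" using assms by auto
    then show ?thesis by simp
  next
    case True
    have w: "w > 0" using assms(3) True by (simp add: w_def)
    have \<rho>: "\<rho> \<ge> 0" using assms(3) True by (simp add: \<rho>_def field_simps)
    have increments: "\<bar>\<psi> t (Suc j) - \<psi> t j\<bar> \<le> 2 / w * \<rho> ^ t * (3 * real k - 2 * real j - 1)"
      if "1 \<le> j" "j < n" for j
      using that
    proof (induction t arbitrary: j)
      case 0
      have "\<bar>\<psi> 0 (Suc j) - \<psi> 0 j\<bar> \<le> 2" using assms(1)[of j] assms(1)[of "Suc j"] 0 by simp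
      also have "w \<le> 3 * real k - 2 * real j - 1" using 0 by (simp add: w_def)
      then have "2 \<le> 2 / w * \<rho> ^ 0 * (3 * real k - 2 * real j - 1)" using w by (simp add: field_simps)
      finally show ?case .
    next
      case (Suc t)
      have "\<bar>\<psi> (Suc t) (Suc j) - \<psi> (Suc t) j\<bar> = \<bar>size_op k n (\<psi> t) (Suc j) - size_op k n (\<psi> t) j\<bar>"
        using Suc.prems by (simp add: assms(2))
      also have "\<dots> \<le> 2 / w * \<rho> ^ t * \<rho> * (3 * real k - 2 * real j - 1)"
        unfolding \<rho>_def
        by (rule size_op_contraction) (use Suc assms(3) w \<rho> in \<open>auto simp: \<rho>_def\<close>)
      finally show ?case by (simp add: mult_ac)
    qed
    have "\<bar>\<psi> t j - \<psi> t i\<bar> \<le> 2 / w * \<rho> ^ t * (quad k j - quad k i)"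
      using assms(5,6)
    proof (induction j rule: dec_induct)
      case (step m)
      have "\<bar>\<psi> t (Suc m) - \<psi> t i\<bar> \<le> \<bar>\<psi> t (Suc m) - \<psi> t m\<bar> + \<bar>\<psi> t m - \<psi> t i\<bar>" by simp
      also have "\<dots> \<le> 2 / w * \<rho> ^ t * (quad k (Suc m) - quad k m) + 2 / w * \<rho> ^ t * (quad k m - quad k i)"
        unfolding quad_Suc using step assms(4) increments[of m] by (intro add_mono) auto
      finally show ?case unfolding distrib_left [symmetric] by simp
    qed simp
    also have "\<dots> \<le> 2 / w * \<rho> ^ t * (quad k n - quad k 1)"
    proof -
      have "quad k p \<le> quad k q" if "p \<le> q" "q \<le> n" for p q
        using that
      proof (induction q rule: dec_induct)
        case (step m)
        have "quad k (Suc m) - quad k m \<ge> 0" unfolding quad_Suc using step assms(3) by simp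
        then show ?case using step by simp
      qed simp
      then have "quad k j \<le> quad k n" "quad k 1 \<le> quad k i" using assms by auto
      then show ?thesis using w \<rho> by (intro mult_left_mono) auto
    qed
    also have "quad k n - quad k 1 = real (n - 1) * (3 * real k - 1 - real n)"
      using True by (simp add: quad_def power2_eq_square of_nat_diff algebra_simps)
    finally show ?thesis by (simp add: w_def \<rho>_def mult_ac)
  qed
qed

section \<open>Functions of the value set\<close>

definition fixed :: "nat \<Rightarrow> (nat \<Rightarrow> nat) \<Rightarrow> nat set" where
  "fixed k \<sigma> = {x \<in> {1..k}. \<sigma> x = x}"

definition set_mean :: "nat \<Rightarrow> (nat set \<Rightarrow> real) \<Rightarrow> nat set \<Rightarrow> real" where
  "set_mean n H F = (\<Sum>v\<in>PiE {..<n} (\<lambda>_. F). H (v ` {..<n})) / real (card F) ^ n"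

definition set_op :: "nat \<Rightarrow> nat \<Rightarrow> (nat set \<Rightarrow> real) \<Rightarrow> nat set \<Rightarrow> real" where
  "set_op k n H J =
     (\<Sum>\<sigma> | \<sigma> permutes ({1..k} - J). set_mean n H (fixed k \<sigma>)) / fact (k - card J)"

lemma fixed_superset: "\<sigma> permutes ({1..k} - J) \<Longrightarrow> J \<subseteq> {1..k} \<Longrightarrow> J \<subseteq> fixed k \<sigma>"
  by (auto simp: fixed_def permutes_not_in)

lemma finite_fixed [simp]: "finite (fixed k \<sigma>)"
  by (simp add: fixed_def)

lemma card_permutes_Diff:
  "J \<subseteq> {1..k} \<Longrightarrow> card {\<sigma>. \<sigma> permutes ({1..k} - J)} = fact (k - card J)"
  by (rule card_permutations) (auto simp: card_Diff_subset finite_subset)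

lemma set_mean_cong:
  assumes "\<And>J. J \<subseteq> F \<Longrightarrow> H J = H' J"
  shows "set_mean n H F = set_mean n H' F"
  unfolding set_mean_def
  by (intro arg_cong2[where f = "(/)"] sum.cong refl assms) (auto simp: PiE_iff)

lemma set_op_cong:
  assumes "\<And>J. J \<subseteq> {1..k} \<Longrightarrow> H J = H' J"
  shows "set_op k n H J = set_op k n H' J"
  unfolding set_op_def
  by (intro arg_cong2[where f = "(/)"] sum.cong refl set_mean_cong assms) (auto simp: fixed_def)

lemma set_mean_sum: "set_mean n (\<lambda>J. (\<Sum>i\<in>A. H i J) / c) F = (\<Sum>i\<in>A. set_mean n (H i) F) / c"
  unfolding set_mean_def sum_divide_distrib [symmetric] by (subst sum.swap) (simp add: mult.commute)

lemma set_op_sum: "set_op k n (\<lambda>J. (\<Sum>i\<in>A. H i J) / c) J = (\<Sum>i\<in>A. set_op k n (H i) J) / c"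
  unfolding set_op_def set_mean_sum sum_divide_distrib [symmetric]
  by (subst sum.swap) (simp add: mult.commute)

lemma set_mean_diff_bound:
  assumes "finite F" "F \<noteq> {}" "\<And>J. J \<subseteq> F \<Longrightarrow> \<bar>H J - H' J\<bar> \<le> c"
  shows "\<bar>set_mean n H F - set_mean n H' F\<bar> \<le> c"
proof -
  have F: "real (card F) ^ n > 0" using assms by (simp add: card_gt_0_iff)
  have "\<bar>(\<Sum>v\<in>PiE {..<n} (\<lambda>_. F). H (v ` {..<n})) - (\<Sum>v\<in>PiE {..<n} (\<lambda>_. F). H' (v ` {..<n}))\<bar>
      \<le> (\<Sum>v\<in>PiE {..<n} (\<lambda>_. F). \<bar>H (v ` {..<n}) - H' (v ` {..<n})\<bar>)"
    unfolding sum_subtractf [symmetric] by (rule sum_abs)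
  also have "\<dots> \<le> (\<Sum>v\<in>PiE {..<n} (\<lambda>_. F). c)"
    by (intro sum_mono assms) (auto simp: PiE_iff)
  also have "\<dots> = c * real (card F) ^ n"
    by (simp add: card_funcsetE)
  finally show ?thesis
    unfolding set_mean_def diff_divide_distrib [symmetric] using F by (simp add: abs_divide field_simps)
qed

lemma set_mean_image:
  assumes "bij \<tau>"
  shows "set_mean n H (\<tau> ` F) = set_mean n (\<lambda>J. H (\<tau> ` J)) F"
proof -
  have inv: "inv \<tau> (\<tau> x) = x" "\<tau> (inv \<tau> x) = x" for x
    using assms by (simp_all add: bij_is_inj bij_is_surj surj_f_inv_f)
  have mem: "inv \<tau> y \<in> F" if "y \<in> \<tau> ` F" for y
    using that inv by auto
  have "(\<Sum>v\<in>PiE {..<n} (\<lambda>_. F). H (\<tau> ` v ` {..<n})) = (\<Sum>v\<in>PiE {..<n} (\<lambda>_. \<tau> ` F). H (v ` {..<n}))"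
    by (rule sum.reindex_bij_witness[where i = "\<lambda>v. restrict (inv \<tau> \<circ> v) {..<n}"
          and j = "\<lambda>v. restrict (\<tau> \<circ> v) {..<n}"])
      (auto simp: inv mem image_image PiE_iff fun_eq_iff extensional_def restrict_def
        intro!: arg_cong[where f = H])
  moreover have "card (\<tau> ` F) = card F"
    using assms by (intro card_image) (auto simp: bij_def inj_on_def)
  ultimately show ?thesis by (simp add: set_mean_def)
qed

lemma sum_permutes_conj:
  assumes "\<tau> permutes S" "A \<subseteq> S"
  shows "(\<Sum>\<sigma> | \<sigma> permutes (S - \<tau> ` A). g \<sigma>) = (\<Sum>\<sigma> | \<sigma> permutes (S - A). g (\<tau> \<circ> \<sigma> \<circ> inv \<tau>))"
proof -
  have S: "\<tau> ` (S - A) = S - \<tau> ` A"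
    using assms by (simp add: image_set_diff permutes_inj permutes_image)
  have bij: "bij \<tau>" using assms(1) by (rule permutes_bij)
  have conj: "\<rho> \<circ> \<sigma> \<circ> inv \<rho> permutes (\<rho> ` B)" if "bij \<rho>" "\<sigma> permutes B" for \<rho> \<sigma> :: "'a \<Rightarrow> 'a" and B
  proof (rule bij_imp_permutes)
    show "bij_betw (\<rho> \<circ> \<sigma> \<circ> inv \<rho>) (\<rho> ` B) (\<rho> ` B)"
    proof (rule bij_betw_trans[of "inv \<rho>" "\<rho> ` B" B "\<rho> \<circ> \<sigma>" "\<rho> ` B"])
      show "bij_betw (inv \<rho>) (\<rho> ` B) B"
        using that by (intro bij_betwI[where g = \<rho>]) (auto simp: bij_is_inj)
      show "bij_betw (\<rho> \<circ> \<sigma>) B (\<rho> ` B)"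
        using that permutes_imp_bij[OF that(2)]
        by (intro bij_betw_trans[of \<sigma> B B \<rho>]) (auto simp: bij_betw_def bij_def inj_on_def)
    qed
    fix x assume "x \<notin> \<rho> ` B"
    then have "inv \<rho> x \<notin> B" using that by (metis bij_inv_eq_iff imageI)
    then show "(\<rho> \<circ> \<sigma> \<circ> inv \<rho>) x = x"
      using that by (simp add: permutes_not_in bij_is_surj surj_f_inv_f)
  qed
  have inverse: "\<tau> (inv \<tau> x) = x" "inv \<tau> (\<tau> x) = x" "inv (inv \<tau>) = \<tau>" for x
    using bij by (simp_all add: inv_inv_eq bij_is_inj bij_is_surj surj_f_inv_f)
  have cancel: "\<tau> \<circ> (inv \<tau> \<circ> \<sigma> \<circ> inv (inv \<tau>)) \<circ> inv \<tau> = \<sigma>"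
    "inv \<tau> \<circ> (\<tau> \<circ> \<sigma> \<circ> inv \<tau>) \<circ> inv (inv \<tau>) = \<sigma>" for \<sigma>
    by (simp_all add: fun_eq_iff inverse)
  show ?thesis
  proof (rule sum.reindex_bij_witness[where i = "\<lambda>\<sigma>. \<tau> \<circ> \<sigma> \<circ> inv \<tau>" and j = "\<lambda>\<sigma>. inv \<tau> \<circ> \<sigma> \<circ> inv (inv \<tau>)"])
    fix \<sigma> assume "\<sigma> \<in> {\<sigma>. \<sigma> permutes (S - \<tau> ` A)}"
    then have "inv \<tau> \<circ> \<sigma> \<circ> inv (inv \<tau>) permutes (inv \<tau> ` (\<tau> ` (S - A)))"
      using conj[of "inv \<tau>" \<sigma> "S - \<tau> ` A"] bij S by (simp add: bij_imp_bij_inv)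
    then show "inv \<tau> \<circ> \<sigma> \<circ> inv (inv \<tau>) \<in> {\<sigma>. \<sigma> permutes (S - A)}"
      using bij by (simp add: image_inv_f_f bij_is_inj)
  next
    fix \<sigma> assume "\<sigma> \<in> {\<sigma>. \<sigma> permutes (S - A)}"
    then show "\<tau> \<circ> \<sigma> \<circ> inv \<tau> \<in> {\<sigma>. \<sigma> permutes (S - \<tau> ` A)}"
      using conj[of \<tau> \<sigma> "S - A"] bij S by simp
  qed (simp_all only: cancel)
qed

lemma fixed_conj:
  assumes "\<tau> permutes {1..k}"
  shows "fixed k (\<tau> \<circ> \<sigma> \<circ> inv \<tau>) = \<tau> ` fixed k \<sigma>"
proof -
  have "x \<in> \<tau> ` fixed k \<sigma>" if "x \<in> fixed k (\<tau> \<circ> \<sigma> \<circ> inv \<tau>)" for x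
  proof (rule image_eqI)
    have "inv \<tau> x \<in> {1..k}"
      using that permutes_in_image[OF permutes_inv[OF assms], of x] by (simp add: fixed_def)
    moreover have "\<sigma> (inv \<tau> x) = inv \<tau> x"
      using that permutes_inv_eq[OF assms] by (simp add: fixed_def) metis
    ultimately show "inv \<tau> x \<in> fixed k \<sigma>" by (simp add: fixed_def)
  qed (simp add: permutes_inverses[OF assms])
  moreover have "\<tau> x \<in> fixed k (\<tau> \<circ> \<sigma> \<circ> inv \<tau>)" if "x \<in> fixed k \<sigma>" for x
    using that permutes_in_image[OF assms, of x] by (simp add: fixed_def permutes_inverses[OF assms])
  ultimately show ?thesis by blast
qed

text \<open>A relabelling commutes with a step: conjugation by \<open>\<tau>\<close> carries the
  permutations fixing J pointwise to those fixing the relabelled J, and moves their fixed points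
  along.\<close>

lemma set_op_image:
  assumes "\<tau> permutes {1..k}" "J \<subseteq> {1..k}"
  shows "set_op k n H (\<tau> ` J) = set_op k n (\<lambda>I. H (\<tau> ` I)) J"
proof -
  have "card (\<tau> ` J) = card J"
    using permutes_inj[OF assms(1)] by (intro card_image) (auto simp: inj_on_def)
  then show ?thesis
    unfolding set_op_def sum_permutes_conj[OF assms] fixed_conj[OF assms(1)]
      set_mean_image[OF permutes_bij[OF assms(1)]] by simp
qed

section \<open>Exchanging labels\<close>

text \<open>The condition has content only if exactly one of a and b is in J; otherwise the exchange
  maps J to itself.\<close>

definition swap_lipschitz :: "nat \<Rightarrow> real \<Rightarrow> (nat set \<Rightarrow> real) \<Rightarrow> bool" where
  "swap_lipschitz k c H \<longleftrightarrow> (\<forall>J a b. J \<subseteq> {1..k} \<longrightarrow> a \<in> {1..k} \<longrightarrow> b \<in> {1..k} \<longrightarrow>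
     \<bar>H J - H (Transposition.transpose a b ` J)\<bar> \<le> c)"

lemma transpose_image_both:
  "(a \<in> J \<longleftrightarrow> b \<in> J) \<Longrightarrow> Transposition.transpose a b ` J = J"
  by (auto simp: Transposition.transpose_def image_iff split: if_splits)

text \<open>If one of two exchanged values is in use and \<open>\<sigma>\<close> happens to fix the other one, then the
  exchange leaves the fixed point set of \<open>\<sigma>\<close> unchanged. For \<open>k = 1\<close> the factor is \<open>-1 / 0 = 0\<close>.\<close>

lemma swap_lipschitz_set_op:
  assumes H: "swap_lipschitz k c H" and c: "c \<ge> 0" and k: "k \<ge> 1"
  shows "swap_lipschitz k (c * ((real k - 2) / (real k - 1))) (set_op k n H)"
proof -
  let ?r = "(real k - 2) / (real k - 1)"
  have r: "?r \<ge> 0" using k by (cases "k = 1") auto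
  have key: "\<bar>set_op k n H J - set_op k n H (Transposition.transpose a b ` J)\<bar> \<le> c * ?r"
    if J: "J \<subseteq> {1..k}" and a: "a \<in> J" and b: "b \<in> {1..k}" "b \<notin> J" for J a b
  proof -
    let ?\<tau> = "Transposition.transpose a b" and ?B = "{1..k} - J" and ?N = "k - card J"
    \<comment> \<open>The permutations in \<open>?Q\<close> fix b as well; only those in
      \<open>?P - ?Q\<close> will contribute.\<close>
    let ?P = "{\<sigma>. \<sigma> permutes ?B}" and ?Q = "{\<sigma>. \<sigma> permutes (?B - {b})}"
    let ?d = "\<lambda>\<sigma>. set_mean n H (fixed k \<sigma>) - set_mean n (\<lambda>I. H (?\<tau> ` I)) (fixed k \<sigma>)"
    have \<tau>: "?\<tau> permutes {1..k}" using J a b by (intro permutes_swap_id) auto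
    have finJ: "finite J" using J finite_subset by auto
    have finP: "finite ?P" by (intro finite_permutations) simp
    have N: "?N \<ge> 1" "?N \<le> k - 1" "k \<ge> 2"
    proof -
      have "card J < card {1..k}" using J b by (intro psubset_card_mono) auto
      then show "?N \<ge> 1" by simp
      have "card J > 0" using a finJ by (auto simp: card_gt_0_iff)
      with \<open>card J < card {1..k}\<close> show "?N \<le> k - 1" "k \<ge> 2" by auto
    qed
    have QP: "?Q \<subseteq> ?P" by (auto intro: permutes_subset)
    have Q: "\<sigma> \<in> ?Q" if "\<sigma> \<in> ?P" "\<sigma> b = b" for \<sigma>
      using that by (auto intro: permutes_superset)
    have cardP: "card ?P = fact ?N" using card_permutes_Diff[OF J] .
    have "card (?B - {b}) = ?N - 1"
      using b J finJ by (simp add: card_Diff_subset)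
    then have cardQ: "card ?Q = fact (?N - 1)"
      by (intro card_permutations) auto
    have cardPQ: "real (card (?P - ?Q)) = fact ?N - fact (?N - 1)"
      using QP finP cardP cardQ
      by (simp add: card_Diff_subset finite_subset of_nat_diff fact_mono)
    have "(\<Sum>\<sigma>\<in>?P. ?d \<sigma>) = (\<Sum>\<sigma>\<in>?P - ?Q. ?d \<sigma>)"
    proof (rule sum.mono_neutral_right[OF finP])
      show "\<forall>\<sigma>\<in>?P - (?P - ?Q). ?d \<sigma> = 0"
      proof
        fix \<sigma> assume "\<sigma> \<in> ?P - (?P - ?Q)"
        then have "\<sigma> permutes ?B" "\<sigma> b = b" using b by (auto simp: permutes_not_in)
        then have "a \<in> fixed k \<sigma>" "b \<in> fixed k \<sigma>"
          using a b J fixed_superset[of \<sigma> k J] by (auto simp: fixed_def)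
        then have "?\<tau> ` fixed k \<sigma> = fixed k \<sigma>" by (intro transpose_image_both) simp
        then show "?d \<sigma> = 0" by (simp flip: set_mean_image)
      qed
    qed auto
    then have "\<bar>\<Sum>\<sigma>\<in>?P. ?d \<sigma>\<bar> \<le> (\<Sum>\<sigma>\<in>?P - ?Q. \<bar>?d \<sigma>\<bar>)"
      by (simp add: sum_abs)
    also have "\<dots> \<le> (\<Sum>\<sigma>\<in>?P - ?Q. c)"
    proof (rule sum_mono)
      fix \<sigma> assume "\<sigma> \<in> ?P - ?Q"
      then have "fixed k \<sigma> \<noteq> {}" using a J fixed_superset[of \<sigma> k J] by auto
      then show "\<bar>?d \<sigma>\<bar> \<le> c"
        using H a b J unfolding swap_lipschitz_def
        by (intro set_mean_diff_bound) (auto simp: fixed_def subset_iff)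
    qed
    finally have "\<bar>\<Sum>\<sigma>\<in>?P. ?d \<sigma>\<bar> \<le> c * (fact ?N - fact (?N - 1))"
      by (simp only: sum_constant cardPQ mult.commute)
    then have "\<bar>(\<Sum>\<sigma>\<in>?P. ?d \<sigma>) / fact ?N\<bar> \<le> c * ((fact ?N - fact (?N - 1)) / fact ?N)"
      by (simp add: abs_divide divide_right_mono)
    also have "(fact ?N - fact (?N - 1)) / fact ?N = 1 - 1 / real ?N"
    proof -
      obtain N' where N': "?N = Suc N'" using N(1) by (cases ?N) auto
      show ?thesis unfolding N' by (simp add: diff_divide_distrib)
    qed
    also have "c * (1 - 1 / real ?N) \<le> c * ?r"
    proof (intro mult_left_mono c)
      have "1 / real ?N \<ge> 1 / (real k - 1)" using N by (intro frac_le) auto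
      then show "1 - 1 / real ?N \<le> ?r" using N by (simp add: field_simps)
    qed
    finally show ?thesis
      unfolding set_op_image[OF \<tau> J] by (simp add: set_op_def sum_subtractf diff_divide_distrib)
  qed
  show ?thesis
    unfolding swap_lipschitz_def
  proof (intro allI impI)
    fix J a b assume "J \<subseteq> {1..k}" "a \<in> {1..k}" "b \<in> {1..k}"
    then show "\<bar>set_op k n H J - set_op k n H (Transposition.transpose a b ` J)\<bar> \<le> c * ?r"
      using key[of J a b] key[of J b a] transpose_image_both[of a J b] mult_nonneg_nonneg[OF c r]
      by (cases "a \<in> J"; cases "b \<in> J") (simp_all add: transpose_commute)
  qed
qed

text \<open>Exchange some a in \<open>J - J'\<close> for some b in \<open>J' - J\<close>, which
  exists as the sizes agree; this costs c and shrinks \<open>J - J'\<close> by one element.\<close>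

lemma swap_lipschitz_path:
  assumes H: "swap_lipschitz k c H" and "J \<subseteq> {1..k}" "J' \<subseteq> {1..k}" "card J = card J'"
  shows "\<bar>H J - H J'\<bar> \<le> real (card (J - J')) * c"
  using assms(2,4)
proof (induction "card (J - J')" arbitrary: J)
  case 0
  then have "finite J" "finite J'" using assms finite_subset[OF _ finite_atLeastAtMost] by blast+
  with 0 have "J \<subseteq> J'" by simp
  then have "J = J'" using 0 \<open>finite J'\<close> by (simp add: card_subset_eq)
  then show ?case by simp
next
  case (Suc d)
  have fin: "finite J" "finite J'"
    using Suc assms finite_subset[OF _ finite_atLeastAtMost] by blast+
  from Suc.hyps(2) obtain a where a: "a \<in> J" "a \<notin> J'" by (metis DiffE card.empty ex_in_conv nat.distinct(1))
  have "\<not> J' \<subseteq> J" using a fin Suc.prems by (metis card_subset_eq)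
  then obtain b where b: "b \<in> J'" "b \<notin> J" by auto
  let ?J = "Transposition.transpose a b ` J"
  have img: "?J = insert b (J - {a})"
    using a b by (auto simp: Transposition.transpose_def image_iff split: if_splits)
  have "?J - J' = (J - J') - {a}" using img a b by auto
  then have d: "card (?J - J') = d" using Suc.hyps(2) a fin by simp
  have "\<bar>H ?J - H J'\<bar> \<le> real (card (?J - J')) * c"
  proof (rule Suc.hyps(1))
    show "?J \<subseteq> {1..k}" using img b assms Suc.prems by auto
    have "card ?J = card J" by (intro card_image) simp
    then show "card ?J = card J'" using Suc.prems by simp
  qed (simp add: d)
  moreover have "\<bar>H J - H ?J\<bar> \<le> c"
    using H Suc.prems a b assms unfolding swap_lipschitz_def by (meson subsetD)
  ultimately show ?case unfolding Suc.hyps(2)[symmetric] d by (simp add: algebra_simps)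
qed

section \<open>Averaging over relabellings\<close>

definition perm_mean :: "nat \<Rightarrow> (nat set \<Rightarrow> real) \<Rightarrow> nat set \<Rightarrow> real" where
  "perm_mean k H J = (\<Sum>\<tau> | \<tau> permutes {1..k}. H (\<tau> ` J)) / fact k"

lemma perm_mean_diff_bound:
  assumes "swap_lipschitz k c H" "J \<subseteq> {1..k}" "c \<ge> 0"
  shows "\<bar>H J - perm_mean k H J\<bar> \<le> real (card J) * c"
proof -
  have cardP: "card {\<tau>. \<tau> permutes {1..k}} = fact k" by (rule card_permutations) auto
  have "\<bar>\<Sum>\<tau> | \<tau> permutes {1..k}. H J - H (\<tau> ` J)\<bar> \<le> (\<Sum>\<tau> | \<tau> permutes {1..k}. \<bar>H J - H (\<tau> ` J)\<bar>)"
    by (rule sum_abs)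
  also have "\<dots> \<le> (\<Sum>\<tau> | \<tau> permutes {1..k}. real (card J) * c)"
  proof (rule sum_mono)
    fix \<tau> assume "\<tau> \<in> {\<tau>. \<tau> permutes {1..k}}"
    then have \<tau>: "\<tau> permutes {1..k}" by simp
    have "\<bar>H J - H (\<tau> ` J)\<bar> \<le> real (card (J - \<tau> ` J)) * c"
    proof (rule swap_lipschitz_path[OF assms(1,2)])
      show "\<tau> ` J \<subseteq> {1..k}" using assms(2) \<tau> by (auto simp: permutes_in_image simp del: atLeastAtMost_iff)
      show "card J = card (\<tau> ` J)"
        using permutes_inj[OF \<tau>] by (intro card_image[symmetric]) (auto simp: inj_on_def)
    qed
    also have "\<dots> \<le> real (card J) * c"
      using assms(2,3) by (intro mult_right_mono of_nat_mono card_mono) (auto intro: finite_subset)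
    finally show "\<bar>H J - H (\<tau> ` J)\<bar> \<le> real (card J) * c" .
  qed
  also have "\<dots> = fact k * (real (card J) * c)" using cardP by simp
  finally have "\<bar>(\<Sum>\<tau> | \<tau> permutes {1..k}. H J - H (\<tau> ` J)) / fact k\<bar> \<le> real (card J) * c"
    by (simp add: abs_divide field_simps)
  then show ?thesis
    using cardP by (simp add: perm_mean_def sum_subtractf diff_divide_distrib)
qed

text \<open>A step commutes with each relabelling, hence with the mean over all of them.\<close>

lemma set_op_perm_mean:
  "J \<subseteq> {1..k} \<Longrightarrow> set_op k n (perm_mean k H) J = perm_mean k (set_op k n H) J"
  unfolding perm_mean_def [abs_def] set_op_sum
  by (intro arg_cong2[where f = "(/)"] sum.cong) (auto simp: set_op_image)

text \<open>The complements in S of A and of its image have equal size, so any bijection between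
  them completes f.\<close>

lemma permutes_extend:
  assumes "finite S" "A \<subseteq> S" "f ` A \<subseteq> S" "inj_on f A"
  obtains \<tau> where "\<tau> permutes S" "\<And>x. x \<in> A \<Longrightarrow> \<tau> x = f x"
proof -
  have fin: "finite A" "finite (f ` A)" using assms finite_subset by auto
  have "card (S - A) = card (S - f ` A)"
    using assms fin by (simp add: card_Diff_subset card_image)
  then obtain g where g: "bij_betw g (S - A) (S - f ` A)"
    using assms fin by (meson finite_Diff finite_same_card_bij)
  define \<tau> where "\<tau> x = (if x \<in> A then f x else if x \<in> S then g x else x)" for x
  have "bij_betw \<tau> (A \<union> (S - A)) (f ` A \<union> (S - f ` A))"
  proof (rule bij_betw_combine)
    show "bij_betw \<tau> A (f ` A)"
      using assms(4) by (subst bij_betw_cong[where g = f]) (auto simp: \<tau>_def bij_betw_def)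
    show "bij_betw \<tau> (S - A) (S - f ` A)"
      using g by (subst bij_betw_cong[where g = g]) (auto simp: \<tau>_def)
  qed auto
  moreover have "A \<union> (S - A) = S" "f ` A \<union> (S - f ` A) = S" using assms by auto
  ultimately have "\<tau> permutes S"
    using assms by (intro bij_imp_permutes) (auto simp: \<tau>_def)
  then show ?thesis by (rule that) (simp add: \<tau>_def)
qed

lemma sum_permutes_compose_right:
  assumes "\<rho> permutes S"
  shows "(\<Sum>\<tau> | \<tau> permutes S. g (\<tau> \<circ> \<rho>)) = (\<Sum>\<tau> | \<tau> permutes S. g \<tau>)"
  by (rule sum.reindex_bij_witness[where i = "\<lambda>\<tau>. \<tau> \<circ> inv \<rho>" and j = "\<lambda>\<tau>. \<tau> \<circ> \<rho>"])
    (auto simp: assms permutes_compose permutes_inv comp_assoc permutes_inv_o[OF assms])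

text \<open>Some permutation \<open>\<rho>\<close> carries J to \<open>J'\<close>, and composition
  with it only permutes the summands.\<close>

lemma perm_mean_cong_card:
  assumes "J \<subseteq> {1..k}" "J' \<subseteq> {1..k}" "card J = card J'"
  shows "perm_mean k H J = perm_mean k H J'"
proof -
  have "finite J" "finite J'" using assms finite_subset[OF _ finite_atLeastAtMost] by blast+
  then obtain f where f: "bij_betw f J J'" using assms(3) by (meson finite_same_card_bij)
  then obtain \<rho> where \<rho>: "\<rho> permutes {1..k}" "\<And>x. x \<in> J \<Longrightarrow> \<rho> x = f x"
    using permutes_extend[of "{1..k}" J f] assms by (auto simp: bij_betw_def)
  have "J' = \<rho> ` J" using f \<rho>(2) by (auto simp: bij_betw_def)
  then have "perm_mean k H J' = (\<Sum>\<tau> | \<tau> permutes {1..k}. H ((\<tau> \<circ> \<rho>) ` J)) / fact k"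
    by (simp add: perm_mean_def image_comp)
  then show ?thesis
    by (simp only: sum_permutes_compose_right[OF \<rho>(1), where g = "\<lambda>\<tau>. H (\<tau> ` J)"] perm_mean_def)
qed

lemma set_op_card:
  assumes "J \<subseteq> {1..k}" "J \<noteq> {}"
  shows "set_op k n (\<lambda>I. \<psi> (card I)) J = size_op k n \<psi> (card J)"
proof -
  let ?B = "{1..k} - J"
  have finJ: "finite J" using assms finite_subset by auto
  have cardB: "card ?B = k - card J" using assms finJ by (simp add: card_Diff_subset)
  have "set_mean n (\<lambda>I. \<psi> (card I)) (fixed k \<sigma>) =
      occ_mean (card J + card {x \<in> ?B. \<sigma> x = x}) n \<psi> 0" if "\<sigma> permutes ?B" for \<sigma>
  proof -
    have ne: "fixed k \<sigma> \<noteq> {}" using fixed_superset[OF that assms(1)] assms(2) by auto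
    have "set_mean n (\<lambda>I. \<psi> (card I)) (fixed k \<sigma>) = occ_mean (card (fixed k \<sigma>)) n \<psi> 0"
      unfolding set_mean_def
      using sum_PiE_card_image[OF finite_fixed ne empty_subsetI, where n = n and \<psi> = \<psi>] ne by simp
    also have "card (fixed k \<sigma>) = card J + card {x \<in> ?B. \<sigma> x = x}"
    proof -
      have "fixed k \<sigma> = J \<union> {x \<in> ?B. \<sigma> x = x}"
        using fixed_superset[OF that assms(1)] by (auto simp: fixed_def)
      then show ?thesis using finJ by (simp only:) (intro card_Un_disjoint; auto)
    qed
    finally show ?thesis .
  qed
  then have "set_op k n (\<lambda>I. \<psi> (card I)) J =
      (\<Sum>\<sigma> | \<sigma> permutes ?B. occ_mean (card J + card {x \<in> ?B. \<sigma> x = x}) n \<psi> 0) / fact (k - card J)"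
    by (simp add: set_op_def)
  also have "\<dots> = size_op k n \<psi> (card J)"
    by (subst sum_permutes_fixpoints) (simp, simp only: cardB, simp add: size_op_def)
  finally show ?thesis .
qed

section \<open>The Burnside process\<close>

lemma states_image: "u \<in> states k n \<Longrightarrow> u ` {..<n} \<subseteq> {1..k}"
  unfolding states_def by (rule image_subsetI) (erule PiE_mem, simp)

lemma finite_states: "finite (states k n)"
  by (simp add: states_def finite_PiE)

lemma act_eq_self_iff:
  "u \<in> states k n \<Longrightarrow> act n \<sigma> u = u \<longleftrightarrow> (\<forall>i<n. \<sigma> (u i) = u i)"
  by (auto simp: act_def states_def fun_eq_iff restrict_def PiE_iff extensional_def)

lemma stab_eq:
  assumes "u \<in> states k n"
  shows "stab k n u = {\<sigma>. \<sigma> permutes ({1..k} - u ` {..<n})}"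
proof (intro set_eqI iffI)
  fix \<sigma> assume "\<sigma> \<in> stab k n u"
  then have "\<sigma> permutes {1..k}" "\<forall>i<n. \<sigma> (u i) = u i"
    using act_eq_self_iff[OF assms] by (auto simp: stab_def)
  then show "\<sigma> \<in> {\<sigma>. \<sigma> permutes ({1..k} - u ` {..<n})}"
    by (auto intro: permutes_superset)
next
  fix \<sigma> assume "\<sigma> \<in> {\<sigma>. \<sigma> permutes ({1..k} - u ` {..<n})}"
  then have \<sigma>: "\<sigma> permutes ({1..k} - u ` {..<n})" by simp
  have "\<sigma> permutes {1..k}" using \<sigma> by (rule permutes_subset) auto
  moreover have "\<sigma> (u i) = u i" if "i < n" for i
    using \<sigma> that by (auto intro: permutes_not_in)
  ultimately show "\<sigma> \<in> stab k n u" using act_eq_self_iff[OF assms] by (simp add: stab_def)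
qed

lemma fixset_eq: "fixset k n \<sigma> = PiE {..<n} (\<lambda>_. fixed k \<sigma>)"
proof (intro set_eqI iffI)
  fix v assume "v \<in> fixset k n \<sigma>"
  then have "v \<in> states k n" "\<forall>i<n. \<sigma> (v i) = v i"
    using act_eq_self_iff[of v k n \<sigma>] by (auto simp: fixset_def)
  then show "v \<in> PiE {..<n} (\<lambda>_. fixed k \<sigma>)"
    by (auto simp: states_def fixed_def PiE_iff)
next
  fix v assume v: "v \<in> PiE {..<n} (\<lambda>_. fixed k \<sigma>)"
  then have "v \<in> states k n" by (auto simp: states_def fixed_def PiE_iff)
  then show "v \<in> fixset k n \<sigma>"
    using v act_eq_self_iff[of v k n \<sigma>] by (auto simp: fixset_def fixed_def PiE_iff)
qed

lemma finite_stab: "u \<in> states k n \<Longrightarrow> finite (stab k n u)"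
  by (simp add: stab_eq finite_permutations)

lemma card_stab: "u \<in> states k n \<Longrightarrow> card (stab k n u) = fact (k - card (u ` {..<n}))"
  unfolding stab_eq by (rule card_permutes_Diff[OF states_image])

text \<open>Interchanging the sums over v and \<open>\<sigma>\<close> recovers the two stages of a
  step: \<open>\<sigma>\<close> uniform in the stabilizer of u, then v uniform among the tuples
  fixed by \<open>\<sigma>\<close>.\<close>

lemma burnsideK_sum:
  assumes u: "u \<in> states k n"
  shows "(\<Sum>v\<in>states k n. burnsideK k n u v * \<Phi> v) =
    (\<Sum>\<sigma> | \<sigma> permutes ({1..k} - u ` {..<n}).
       (\<Sum>v\<in>PiE {..<n} (\<lambda>_. fixed k \<sigma>). \<Phi> v) / real (card (fixed k \<sigma>)) ^ n) / fact (k - card (u ` {..<n}))"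
proof -
  let ?g = "\<lambda>\<sigma>. 1 / (real (card (stab k n u)) * real (card (fixset k n \<sigma>)))"
  have fin: "finite (stab k n u)" using u by (rule finite_stab)
  have "(\<Sum>v\<in>states k n. burnsideK k n u v * \<Phi> v) =
      (\<Sum>v\<in>states k n. \<Sum>\<sigma>\<in>stab k n u. if \<sigma> \<in> stab k n v then ?g \<sigma> * \<Phi> v else 0)"
    unfolding burnsideK_def sum_distrib_right using fin
    by (intro sum.cong[OF refl]) (rule sum.inter_restrict)
  also have "\<dots> = (\<Sum>\<sigma>\<in>stab k n u. \<Sum>v\<in>states k n. if \<sigma> \<in> stab k n v then ?g \<sigma> * \<Phi> v else 0)"
    by (rule sum.swap)
  also have "\<dots> = (\<Sum>\<sigma>\<in>stab k n u. \<Sum>v\<in>fixset k n \<sigma>. ?g \<sigma> * \<Phi> v)"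
  proof (rule sum.cong[OF refl])
    fix \<sigma> assume "\<sigma> \<in> stab k n u"
    then have "{v \<in> states k n. \<sigma> \<in> stab k n v} = fixset k n \<sigma>"
      by (auto simp: stab_def fixset_def)
    then show "(\<Sum>v\<in>states k n. if \<sigma> \<in> stab k n v then ?g \<sigma> * \<Phi> v else 0) =
        (\<Sum>v\<in>fixset k n \<sigma>. ?g \<sigma> * \<Phi> v)"
      by (simp flip: sum.inter_filter[OF finite_states])
  qed
  also have "\<dots> = (\<Sum>\<sigma>\<in>stab k n u. (\<Sum>v\<in>fixset k n \<sigma>. \<Phi> v) / real (card (fixset k n \<sigma>))) / real (card (stab k n u))"
    by (simp add: sum_divide_distrib mult.commute)
  finally show ?thesis
    unfolding card_stab[OF u] unfolding stab_eq[OF u] fixset_eq by (simp add: card_funcsetE)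
qed

lemma burnsideK_sum_image:
  "u \<in> states k n \<Longrightarrow> (\<Sum>v\<in>states k n. burnsideK k n u v * H (v ` {..<n})) = set_op k n H (u ` {..<n})"
  by (simp add: burnsideK_sum set_op_def set_mean_def)

lemma burnsideK_row_sum:
  assumes "u \<in> states k n" "n \<ge> 1"
  shows "(\<Sum>v\<in>states k n. burnsideK k n u v) = 1"
proof -
  have "u 0 \<in> u ` {..<n}" using assms by simp
  then have "fixed k \<sigma> \<noteq> {}" if "\<sigma> permutes ({1..k} - u ` {..<n})" for \<sigma>
    using fixed_superset[OF that states_image[OF assms(1)]] by blast
  then have "(\<Sum>\<sigma> | \<sigma> permutes ({1..k} - u ` {..<n}).
       (\<Sum>v\<in>PiE {..<n} (\<lambda>_. fixed k \<sigma>). 1) / real (card (fixed k \<sigma>)) ^ n) =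
      (\<Sum>\<sigma> | \<sigma> permutes ({1..k} - u ` {..<n}). 1)"
    by (intro sum.cong) (auto simp: card_funcsetE)
  then show ?thesis
    using burnsideK_sum[OF assms(1), of "\<lambda>_. 1"] card_permutes_Diff[OF states_image[OF assms(1)]] by simp
qed

text \<open>Given its value set, the next state is uniform, so a test function may be averaged over the
  tuples with equal value set before a step. An empty class yields the junk value \<open>0 / 0 = 0\<close>.\<close>

definition image_mean :: "nat \<Rightarrow> nat \<Rightarrow> ((nat \<Rightarrow> nat) \<Rightarrow> real) \<Rightarrow> nat set \<Rightarrow> real" where
  "image_mean k n \<Phi> J = (\<Sum>v | v \<in> states k n \<and> v ` {..<n} = J. \<Phi> v) /
     real (card {v \<in> states k n. v ` {..<n} = J})"

text \<open>Along with a tuple over F, every state with the same value set is a tuple over F, so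
  whole classes are averaged.\<close>

lemma sum_image_mean:
  assumes "F \<subseteq> {1..k}"
  shows "(\<Sum>v\<in>PiE {..<n} (\<lambda>_. F). image_mean k n \<Phi> (v ` {..<n})) = (\<Sum>v\<in>PiE {..<n} (\<lambda>_. F). \<Phi> v)"
proof -
  let ?A = "PiE {..<n} (\<lambda>_. F)" and ?im = "\<lambda>v. v ` {..<n}"
  have finF: "finite F" using assms finite_subset by blast
  have finA: "finite ?A" using finF by (simp add: finite_PiE)
  have "(\<Sum>v | v \<in> ?A \<and> ?im v = J. image_mean k n \<Phi> (?im v)) = (\<Sum>v | v \<in> ?A \<and> ?im v = J. \<Phi> v)"
    if "J \<in> ?im ` ?A" for J
  proof -
    have J: "J \<subseteq> F" using that by (auto simp: PiE_iff)
    have eq: "{v. v \<in> ?A \<and> ?im v = J} = {v. v \<in> states k n \<and> ?im v = J}"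
      using J assms by (auto simp: states_def PiE_iff)
    have "{v. v \<in> ?A \<and> ?im v = J} \<noteq> {}" using that by auto
    then have "card {v. v \<in> states k n \<and> ?im v = J} \<noteq> 0"
      unfolding eq[symmetric] using finA by simp
    moreover have "(\<Sum>v | v \<in> ?A \<and> ?im v = J. image_mean k n \<Phi> (?im v)) =
        (\<Sum>v | v \<in> ?A \<and> ?im v = J. image_mean k n \<Phi> J)"
      by (intro sum.cong) auto
    ultimately show ?thesis by (simp add: eq image_mean_def)
  qed
  then have "(\<Sum>J\<in>?im ` ?A. \<Sum>v | v \<in> ?A \<and> ?im v = J. image_mean k n \<Phi> (?im v)) =
      (\<Sum>J\<in>?im ` ?A. \<Sum>v | v \<in> ?A \<and> ?im v = J. \<Phi> v)"
    by (rule sum.cong[OF refl])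
  then show ?thesis
    by (simp only: sum.group[OF finA finite_imageI[OF finA] order_refl])
qed

lemma abs_image_mean_le:
  assumes "\<And>v. v \<in> states k n \<Longrightarrow> \<bar>\<Phi> v\<bar> \<le> 1"
  shows "\<bar>image_mean k n \<Phi> J\<bar> \<le> 1"
proof -
  let ?S = "{v. v \<in> states k n \<and> v ` {..<n} = J}"
  have "\<bar>\<Sum>v\<in>?S. \<Phi> v\<bar> \<le> (\<Sum>v\<in>?S. 1)"
    by (intro order_trans[OF sum_abs] sum_mono) (use assms in auto)
  then show ?thesis
    by (cases "card ?S = 0") (auto simp: image_mean_def abs_divide divide_le_eq)
qed

lemma burnsideK_sum_image_mean:
  assumes "u \<in> states k n"
  shows "(\<Sum>v\<in>states k n. burnsideK k n u v * \<Phi> v) = set_op k n (image_mean k n \<Phi>) (u ` {..<n})"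
proof -
  have "fixed k \<sigma> \<subseteq> {1..k}" for \<sigma> by (auto simp: fixed_def)
  then show ?thesis
    unfolding burnsideK_sum[OF assms] set_op_def set_mean_def by (simp add: sum_image_mean)
qed

section \<open>Powers of the transition matrix\<close>

lemma burnsideK_pow_Suc_sum:
  "(\<Sum>v\<in>states k n. burnsideK_pow k n (Suc t) u v * \<Phi> v) =
     (\<Sum>w\<in>states k n. burnsideK_pow k n t u w * (\<Sum>v\<in>states k n. burnsideK k n w v * \<Phi> v))"
  by (simp add: sum_distrib_left sum_distrib_right mult.assoc) (rule sum.swap)

lemma burnsideK_pow_sum_image:
  assumes "u \<in> states k n"
  shows "(\<Sum>v\<in>states k n. burnsideK_pow k n t u v * H (v ` {..<n})) = (set_op k n ^^ t) H (u ` {..<n})"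
proof (induction t arbitrary: H)
  case 0
  then show ?case
    using assms by (simp add: finite_states if_distrib[of "\<lambda>x. x * _"] cong: if_cong)
next
  case (Suc t)
  have "(\<Sum>v\<in>states k n. burnsideK_pow k n (Suc t) u v * H (v ` {..<n})) =
      (\<Sum>w\<in>states k n. burnsideK_pow k n t u w * set_op k n H (w ` {..<n}))"
    unfolding burnsideK_pow_Suc_sum by (intro sum.cong) (auto simp: burnsideK_sum_image)
  also have "\<dots> = (set_op k n ^^ t) (set_op k n H) (u ` {..<n})"
    by (rule Suc.IH)
  finally show ?case by (simp add: funpow_swap1)
qed

text \<open>The last step averages the test function over value classes, and the earlier steps see
  only value sets; hence \<open>t \<ge> 1\<close>.\<close>

lemma burnsideK_pow_sum:
  assumes "u \<in> states k n" "t \<ge> 1"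
  shows "(\<Sum>v\<in>states k n. burnsideK_pow k n t u v * \<Phi> v) =
    (set_op k n ^^ t) (image_mean k n \<Phi>) (u ` {..<n})"
proof -
  obtain t' where t: "t = Suc t'" using assms(2) by (cases t) auto
  have "(\<Sum>v\<in>states k n. burnsideK_pow k n t u v * \<Phi> v) =
      (\<Sum>w\<in>states k n. burnsideK_pow k n t' u w * set_op k n (image_mean k n \<Phi>) (w ` {..<n}))"
    unfolding t burnsideK_pow_Suc_sum by (intro sum.cong) (auto simp: burnsideK_sum_image_mean)
  also have "\<dots> = (set_op k n ^^ t') (set_op k n (image_mean k n \<Phi>)) (u ` {..<n})"
    by (rule burnsideK_pow_sum_image[OF assms(1)])
  finally show ?thesis by (simp add: t funpow_swap1)
qed

lemma burnsideK_nonneg: "burnsideK k n u v \<ge> 0"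
  unfolding burnsideK_def by (intro sum_nonneg) simp

lemma burnsideK_pow_nonneg: "burnsideK_pow k n t u v \<ge> 0"
  by (induction t arbitrary: v) (auto intro!: sum_nonneg mult_nonneg_nonneg burnsideK_nonneg)

lemma burnsideK_pow_row_sum:
  assumes "u \<in> states k n" "n \<ge> 1"
  shows "(\<Sum>v\<in>states k n. burnsideK_pow k n t u v) = 1"
proof (induction t)
  case 0
  then show ?case using assms by (simp add: finite_states)
next
  case (Suc t)
  then show ?case
    using burnsideK_pow_Suc_sum[of k n t u "\<lambda>_. 1"] burnsideK_row_sum[OF _ assms(2)] by simp
qed

section \<open>Stationarity\<close>

text \<open>The fibres of the map from \<open>\<sigma>\<close> to \<open>act n \<sigma> u\<close>
  are left cosets of the stabilizer.\<close>

lemma orbit_stabilizer: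
  assumes u: "u \<in> states k n"
  shows "card (orbit k n u) * fact (k - card (u ` {..<n})) = fact k"
proof -
  let ?P = "{\<sigma>. \<sigma> permutes {1..k}}"
  have finP: "finite ?P" by (intro finite_permutations) simp
  have orbit: "orbit k n u = (\<lambda>\<sigma>. act n \<sigma> u) ` ?P" by (auto simp: orbit_def)
  have fibre: "card {\<sigma> \<in> ?P. act n \<sigma> u = w} = fact (k - card (u ` {..<n}))" if w_orbit: "w \<in> orbit k n u" for w
  proof -
    obtain \<rho> where \<rho>: "\<rho> permutes {1..k}" and w: "w = act n \<rho> u" using w_orbit unfolding orbit_def by blast
    have inv: "\<rho> (inv \<rho> x) = x" "inv \<rho> (\<rho> x) = x" for x using permutes_inverses[OF \<rho>] by auto
    have "bij_betw (\<lambda>\<sigma>. \<rho> \<circ> \<sigma>) (stab k n u) {\<sigma> \<in> ?P. act n \<sigma> u = w}"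
    proof (rule bij_betwI[where g = "\<lambda>\<sigma>. inv \<rho> \<circ> \<sigma>"])
      show "(\<lambda>\<sigma>. \<rho> \<circ> \<sigma>) \<in> stab k n u \<rightarrow> {\<sigma> \<in> ?P. act n \<sigma> u = w}"
      proof
        fix \<sigma> assume "\<sigma> \<in> stab k n u"
        then have "\<sigma> permutes {1..k}" "\<forall>i<n. \<sigma> (u i) = u i"
          using act_eq_self_iff[OF u] by (auto simp: stab_def)
        then show "\<rho> \<circ> \<sigma> \<in> {\<sigma> \<in> ?P. act n \<sigma> u = w}"
          using \<rho> by (auto simp: w act_def restrict_def fun_eq_iff intro: permutes_compose)
      qed
      show "(\<lambda>\<sigma>. inv \<rho> \<circ> \<sigma>) \<in> {\<sigma> \<in> ?P. act n \<sigma> u = w} \<rightarrow> stab k n u"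
      proof
        fix \<sigma> assume "\<sigma> \<in> {\<sigma> \<in> ?P. act n \<sigma> u = w}"
        then have "\<sigma> permutes {1..k}" and eq: "act n \<sigma> u = act n \<rho> u" by (auto simp: w)
        have "\<sigma> (u i) = \<rho> (u i)" if "i < n" for i
          using fun_cong[OF eq, of i] that by (simp add: act_def)
        then show "inv \<rho> \<circ> \<sigma> \<in> stab k n u"
          using \<rho> \<open>\<sigma> permutes {1..k}\<close> act_eq_self_iff[OF u, of "inv \<rho> \<circ> \<sigma>"]
          by (simp add: stab_def permutes_compose permutes_inv inv)
      qed
    qed (auto simp: fun_eq_iff inv)
    from bij_betw_same_card[OF this] show ?thesis by (simp add: card_stab[OF u])
  qed
  have "fact k = card ?P" by (rule card_permutations[symmetric]) auto
  also have "\<dots> = (\<Sum>w\<in>orbit k n u. card {\<sigma> \<in> ?P. act n \<sigma> u = w})"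
    using sum.group[OF finP finite_imageI[OF finP] order_refl, where g = "\<lambda>\<sigma>. act n \<sigma> u" and h = "\<lambda>_. 1::nat"]
    by (simp add: orbit)
  also have "\<dots> = (\<Sum>w\<in>orbit k n u. fact (k - card (u ` {..<n})))"
    by (rule sum.cong[OF refl fibre])
  finally show ?thesis by simp
qed

lemma burnside_pi_eq:
  assumes "u \<in> states k n"
  shows "burnside_pi k n u = fact (k - card (u ` {..<n})) / (real (Bell n) * fact k)"
proof -
  have "real (card (orbit k n u)) * fact (k - card (u ` {..<n})) = fact k"
    using arg_cong[OF orbit_stabilizer[OF assms], of real] by simp
  moreover from this have "real (card (orbit k n u)) \<noteq> 0" by (metis fact_nonzero mult_zero_left)
  ultimately show ?thesis
    by (simp add: burnside_pi_def flip: \<open>_ = fact k\<close>)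
qed

text \<open>By orbit and stabilizer, \<open>burnside_pi k n u / card (stab k n u)\<close> is
  \<open>1 / (Bell n * fact k)\<close> for every u, which leaves a sum symmetric in u and v.\<close>

lemma burnside_reversible:
  assumes "u \<in> states k n" "v \<in> states k n"
  shows "burnside_pi k n u * burnsideK k n u v = burnside_pi k n v * burnsideK k n v u"
proof -
  have "burnside_pi k n u * burnsideK k n u v =
      (\<Sum>\<sigma>\<in>stab k n u \<inter> stab k n v. 1 / (real (Bell n) * fact k * real (card (fixset k n \<sigma>))))"
    if "u \<in> states k n" for u v
    using that unfolding burnsideK_def sum_distrib_left
    by (intro sum.cong) (auto simp: burnside_pi_eq card_stab)
  from this[OF assms(1), of v] this[OF assms(2), of u] show ?thesis by (simp add: Int_commute)
qed

lemma burnside_stationary: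
  assumes "v \<in> states k n" "n \<ge> 1"
  shows "(\<Sum>u\<in>states k n. burnside_pi k n u * burnsideK_pow k n t u v) = burnside_pi k n v"
  using assms(1)
proof (induction t arbitrary: v)
  case 0
  then show ?case by (simp add: finite_states if_distrib[of "\<lambda>x. _ * x"] cong: if_cong)
next
  case (Suc t)
  have "(\<Sum>u\<in>states k n. burnside_pi k n u * burnsideK_pow k n (Suc t) u v) =
      (\<Sum>w\<in>states k n. (\<Sum>u\<in>states k n. burnside_pi k n u * burnsideK_pow k n t u w) * burnsideK k n w v)"
    by (simp add: sum_distrib_left sum_distrib_right mult.assoc) (rule sum.swap)
  also have "\<dots> = (\<Sum>w\<in>states k n. burnside_pi k n v * burnsideK k n v w)"
    using Suc by (intro sum.cong) (simp_all add: burnside_reversible)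
  also have "\<dots> = burnside_pi k n v"
    using burnsideK_row_sum[OF Suc.prems assms(2)] by (simp flip: sum_distrib_left)
  finally show ?case .
qed

section \<open>Orbits and set partitions\<close>

text \<open>The set partition of the indices into level sets; it will label the orbit of u.\<close>

definition kernel :: "nat \<Rightarrow> (nat \<Rightarrow> nat) \<Rightarrow> nat set set" where
  "kernel n u = (\<lambda>a. {i \<in> {..<n}. u i = a}) ` u ` {..<n}"

lemma kernel_eq_iff: "kernel n u = kernel n v \<longleftrightarrow> (\<forall>i<n. \<forall>j<n. u i = u j \<longleftrightarrow> v i = v j)"
proof
  assume eq: "kernel n u = kernel n v"
  show "\<forall>i<n. \<forall>j<n. u i = u j \<longleftrightarrow> v i = v j"
  proof (intro allI impI)
    fix i j assume ij: "i < n" "j < n"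
    have "{l \<in> {..<n}. u l = u i} \<in> kernel n v"
      using ij unfolding eq[symmetric] by (auto simp: kernel_def)
    then obtain a where a: "{l \<in> {..<n}. u l = u i} = {l \<in> {..<n}. v l = a}" by (auto simp: kernel_def)
    have "l < n \<and> u l = u i \<longleftrightarrow> l < n \<and> v l = a" for l using a by (auto simp: set_eq_iff)
    from this[of i] this[of j] ij show "u i = u j \<longleftrightarrow> v i = v j" by metis
  qed
next
  assume iff: "\<forall>i<n. \<forall>j<n. u i = u j \<longleftrightarrow> v i = v j"
  have "{l \<in> {..<n}. u l = u i} = {l \<in> {..<n}. v l = v i}" if "i < n" for i
    using iff that by auto
  then show "kernel n u = kernel n v"
    unfolding kernel_def image_image by (intro image_cong) auto
qed

lemma partition_on_kernel: "partition_on {..<n} (kernel n u)"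
  by (rule partition_onI) (auto simp: kernel_def disjnt_def)

lemma kernel_surj:
  assumes P: "partition_on {..<n} P" and "n \<le> k"
  obtains u where "u \<in> states k n" "kernel n u = P"
proof -
  have "\<exists>B. B \<in> P \<and> i \<in> B" if "i < n" for i
    using partition_onD1[OF P] that by auto
  then obtain b where b: "\<And>i. i < n \<Longrightarrow> b i \<in> P \<and> i \<in> b i" by metis
  have sub: "B \<subseteq> {..<n}" and ne: "B \<noteq> {}" if "B \<in> P" for B
    using that partition_onD1[OF P] partition_onD3[OF P] by auto
  have fin: "finite B" if "B \<in> P" for B
    using sub[OF that] by (rule finite_subset) simp
  have disj: "B = B'" if "B \<in> P" "B' \<in> P" "x \<in> B" "x \<in> B'" for B B' x
    using that partition_onD2[OF P] by (auto simp: disjoint_def)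
  have b_eq: "b i = B" if "B \<in> P" "i \<in> B" for i B
    using that b[of i] sub[of B] disj[of "b i" B i] by auto
  \<comment> \<open>The least index of a block serves as its value; \<open>Suc\<close> moves it into
    \<open>{1..n}\<close>, and \<open>n \<le> k\<close>.\<close>
  define u where "u = restrict (\<lambda>i. Suc (Min (b i))) {..<n}"
  have u_eq: "u i = u j \<longleftrightarrow> b i = b j" if "i < n" "j < n" for i j
    using that b[of i] b[of j] disj[of "b i" "b j" "Min (b i)"] Min_in[OF fin ne]
    by (auto simp: u_def)
  have "u i \<in> {1..k}" if "i < n" for i
    using that b[of i] Min_in[OF fin ne, of "b i"] sub[of "b i"] assms(2) by (fastforce simp: u_def)
  then have "u \<in> states k n" by (simp add: states_def PiE_iff u_def)
  moreover have "kernel n u = P"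
  proof -
    have block: "{j \<in> {..<n}. u j = u i} = b i" if "i < n" for i
    proof -
      have "j < n \<and> b j = b i \<longleftrightarrow> j \<in> b i" for j
        using that b b_eq sub by (metis lessThan_iff subsetD)
      then show ?thesis using u_eq[OF _ that] by auto
    qed
    have "kernel n u = b ` {..<n}"
      unfolding kernel_def image_image by (intro image_cong[OF refl] block) simp
    also have "\<dots> = P"
    proof (intro set_eqI iffI)
      fix B assume "B \<in> P"
      then obtain i where "i \<in> B" using ne by auto
      then show "B \<in> b ` {..<n}" using \<open>B \<in> P\<close> sub b_eq by force
    qed (use b in auto)
    finally show ?thesis .
  qed
  ultimately show ?thesis by (rule that)
qed

lemma act_in_states:
  assumes "\<tau> permutes {1..k}" "u \<in> states k n"
  shows "act n \<tau> u \<in> states k n"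
  using assms(2) permutes_in_image[OF assms(1)] unfolding states_def act_def by auto

lemma act_image: "act n \<tau> u ` {..<n} = \<tau> ` u ` {..<n}"
  by (simp add: act_def image_image cong: image_cong_simp)

lemma card_image_permutes: "\<tau> permutes S \<Longrightarrow> card (\<tau> ` J) = card J"
  by (intro card_image permutes_inj_on)

text \<open>Tuples with equal level sets differ by the injection sending \<open>u i\<close> to
  \<open>v i\<close>, which extends to a permutation.\<close>

lemma orbit_eq_kernel:
  assumes u: "u \<in> states k n"
  shows "orbit k n u = {v \<in> states k n. kernel n v = kernel n u}"
proof (intro set_eqI iffI)
  fix v assume "v \<in> orbit k n u"
  then obtain \<tau> where \<tau>: "\<tau> permutes {1..k}" "v = act n \<tau> u" unfolding orbit_def by blast
  then have "kernel n v = kernel n u"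
    using permutes_inj[OF \<tau>(1)] by (simp add: kernel_eq_iff act_def inj_eq)
  then show "v \<in> {v \<in> states k n. kernel n v = kernel n u}"
    using act_in_states[OF \<tau>(1) u] \<tau>(2) by simp
next
  fix v assume "v \<in> {v \<in> states k n. kernel n v = kernel n u}"
  then have v: "v \<in> states k n" and iff: "\<And>i j. i < n \<Longrightarrow> j < n \<Longrightarrow> v i = v j \<longleftrightarrow> u i = u j"
    by (auto simp: kernel_eq_iff)
  \<comment> \<open>Every index i with \<open>u i = a\<close> gives the same \<open>v i\<close>, so
    the choice is immaterial.\<close>
  define f where "f a = v (SOME i. i < n \<and> u i = a)" for a
  have f: "f (u i) = v i" if "i < n" for i
  proof -
    have "(SOME j. j < n \<and> u j = u i) < n \<and> u (SOME j. j < n \<and> u j = u i) = u i"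
      by (rule someI[of _ i]) (simp add: that)
    with iff that show ?thesis by (simp add: f_def)
  qed
  have "inj_on f (u ` {..<n})" using f iff by (auto simp: inj_on_def)
  moreover have "f ` u ` {..<n} \<subseteq> {1..k}"
    using f states_image[OF v] by (auto simp: image_subset_iff)
  ultimately obtain \<tau> where \<tau>: "\<tau> permutes {1..k}" "\<And>x. x \<in> u ` {..<n} \<Longrightarrow> \<tau> x = f x"
    using permutes_extend[of "{1..k}" "u ` {..<n}" f] states_image[OF u] by blast
  have "v = act n \<tau> u"
    using v f \<tau>(2) by (auto simp: act_def restrict_def fun_eq_iff states_def PiE_iff extensional_def)
  then show "v \<in> orbit k n u" using \<tau>(1) unfolding orbit_def by blast
qed

text \<open>Each orbit has mass \<open>1 / Bell n\<close>, and since \<open>n \<le> k\<close> every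
  set partition arises from an orbit.\<close>

lemma burnside_pi_sum:
  assumes "n \<le> k"
  shows "(\<Sum>u\<in>states k n. burnside_pi k n u) = 1"
proof -
  let ?Ps = "{P. partition_on {..<n} P}"
  have finPs: "finite ?Ps" by (simp add: finitely_many_partition_on)
  have "?Ps \<noteq> {}" using partition_on_kernel by blast
  then have Bell: "real (Bell n) > 0" using finPs by (simp add: Bell_def card_gt_0_iff)
  have fibre: "(\<Sum>u | u \<in> states k n \<and> kernel n u = P. burnside_pi k n u) = 1 / real (Bell n)"
    if P: "P \<in> ?Ps" for P
  proof -
    obtain u0 where u0: "u0 \<in> states k n" "kernel n u0 = P" using kernel_surj[OF _ assms] P by blast
    have orbit: "orbit k n u = {u. u \<in> states k n \<and> kernel n u = P}"
      if "u \<in> states k n" "kernel n u = P" for u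
      using orbit_eq_kernel[OF that(1)] that(2) by simp
    have card: "card (orbit k n u0) \<noteq> 0"
      using orbit_stabilizer[OF u0(1)] by (metis fact_nonzero mult_zero_left)
    have "(\<Sum>u | u \<in> states k n \<and> kernel n u = P. burnside_pi k n u) =
        (\<Sum>u\<in>orbit k n u0. 1 / (real (Bell n) * real (card (orbit k n u0))))"
      unfolding orbit[OF u0] by (intro sum.cong) (auto simp: burnside_pi_def orbit)
    then show ?thesis using card by simp
  qed
  have "(\<Sum>u\<in>states k n. burnside_pi k n u) =
      (\<Sum>P\<in>?Ps. \<Sum>u | u \<in> states k n \<and> kernel n u = P. burnside_pi k n u)"
    by (rule sum.group[symmetric, OF finite_states finPs]) (auto simp: partition_on_kernel)
  also have "\<dots> = (\<Sum>P\<in>?Ps. 1 / real (Bell n))" by (rule sum.cong[OF refl fibre])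
  also have "\<dots> = 1" using Bell by (simp add: Bell_def)
  finally show ?thesis .
qed

lemma burnside_pi_nonneg: "burnside_pi k n u \<ge> 0"
  by (simp add: burnside_pi_def)

text \<open>On states, \<open>burnside_pi\<close> depends only on the number of values, so it is
  invariant under relabelling.\<close>

lemma burnside_pi_sum_perm_mean:
  "(\<Sum>u\<in>states k n. burnside_pi k n u * perm_mean k H (u ` {..<n})) =
   (\<Sum>u\<in>states k n. burnside_pi k n u * H (u ` {..<n}))"
proof -
  let ?P = "{\<tau>. \<tau> permutes {1..k}}"
  have "(\<Sum>u\<in>states k n. burnside_pi k n u * H (\<tau> ` u ` {..<n})) =
      (\<Sum>u\<in>states k n. burnside_pi k n u * H (u ` {..<n}))" if "\<tau> \<in> ?P" for \<tau>
  proof (rule sum.reindex_bij_witness[where i = "act n (inv \<tau>)" and j = "act n \<tau>"])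
    have \<tau>: "\<tau> permutes {1..k}" using that by simp
    fix u assume u: "u \<in> states k n"
    show "act n \<tau> u \<in> states k n" "act n (inv \<tau>) u \<in> states k n"
      using act_in_states[OF \<tau> u] act_in_states[OF permutes_inv[OF \<tau>] u] by auto
    show "act n (inv \<tau>) (act n \<tau> u) = u" "act n \<tau> (act n (inv \<tau>) u) = u"
      using u permutes_inverses[OF \<tau>]
      by (auto simp: act_def states_def PiE_iff extensional_def fun_eq_iff)
    show "burnside_pi k n (act n \<tau> u) * H (act n \<tau> u ` {..<n}) = burnside_pi k n u * H (\<tau> ` u ` {..<n})"
      using u \<tau> by (simp only: burnside_pi_eq act_in_states act_image card_image_permutes)
  qed
  then have "(\<Sum>\<tau>\<in>?P. \<Sum>u\<in>states k n. burnside_pi k n u * H (\<tau> ` u ` {..<n})) =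
      (\<Sum>\<tau>\<in>?P. \<Sum>u\<in>states k n. burnside_pi k n u * H (u ` {..<n}))"
    by (rule sum.cong[OF refl])
  also have "\<dots> = fact k * (\<Sum>u\<in>states k n. burnside_pi k n u * H (u ` {..<n}))"
    using card_permutations[of "{1..k}" k] by simp
  finally have "(\<Sum>u\<in>states k n. \<Sum>\<tau>\<in>?P. burnside_pi k n u * H (\<tau> ` u ` {..<n})) =
      fact k * (\<Sum>u\<in>states k n. burnside_pi k n u * H (u ` {..<n}))"
    by (subst sum.swap)
  then show ?thesis
    by (simp add: perm_mean_def sum_distrib_left [symmetric] sum_divide_distrib [symmetric])
qed

section \<open>Total variation bounded by two rates\<close>

lemma tv_dist_le_1:
  assumes "1 \<le> n" "n \<le> k" "u \<in> states k n"
  shows "tv_dist k n t u \<le> 1"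
proof -
  have "(\<Sum>v\<in>states k n. \<bar>burnsideK_pow k n t u v - burnside_pi k n v\<bar>) \<le>
      (\<Sum>v\<in>states k n. burnsideK_pow k n t u v + burnside_pi k n v)"
    using burnsideK_pow_nonneg[of k n t u] burnside_pi_nonneg[of k n]
    by (intro sum_mono) (simp add: abs_le_iff add_increasing add_increasing2)
  also have "\<dots> = 2"
    using assms by (simp add: sum.distrib burnsideK_pow_row_sum burnside_pi_sum)
  finally show ?thesis by (simp add: tv_dist_def)
qed

text \<open>The distance is tested against the sign \<open>\<epsilon>\<close> of the difference.
  After t steps this becomes a function \<open>H t\<close> of the value set; its deviation from the
  mean over relabellings gives the first term, the oscillation of that mean in the block count the
  second. Both carry a factor 2 from the range of \<open>\<epsilon>\<close>, which cancels the half
  in \<open>tv_dist\<close>.\<close>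

lemma tv_dist_le_two_rates:
  assumes "1 \<le> n" "n \<le> k" "u \<in> states k n" "1 \<le> t"
  shows "tv_dist k n t u \<le> real n * ((real k - 2) / (real k - 1)) ^ t +
    real (n - 1) * (3 * real k - 1 - real n) / (3 * real k - 2 * real n + 1) * (1 - 2 / (3 * real k - 3)) ^ t"
proof -
  define \<epsilon> :: "(nat \<Rightarrow> nat) \<Rightarrow> real" where
    "\<epsilon> v = (if burnside_pi k n v \<le> burnsideK_pow k n t u v then 1 else - 1)" for v
  define H where "H t = (set_op k n ^^ t) (image_mean k n \<epsilon>)" for t
  \<comment> \<open>The mean over relabellings depends on the size alone, so \<open>{1..j}\<close>
    represents all value sets of size j.\<close>
  define \<psi> where "\<psi> t j = perm_mean k (H t) {1..j}" for t j
  define r where "r = (real k - 2) / (real k - 1)"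
  define osc where "osc = 2 * (1 - 2 / (3 * real k - 3)) ^ t *
    (real (n - 1) * (3 * real k - 1 - real n) / (3 * real k - 2 * real n + 1))"
  have r: "r \<ge> 0" using assms by (cases "k = 1") (auto simp: r_def)
  have H0: "\<bar>H 0 J\<bar> \<le> 1" for J
    unfolding H_def by (simp add: abs_image_mean_le \<epsilon>_def)
  have "swap_lipschitz k (2 * r ^ t) (H t)" for t
  proof (induction t)
    case 0
    have "\<bar>H 0 J - H 0 J'\<bar> \<le> 2" for J J' using H0[of J] H0[of J'] by simp
    then show ?case by (simp add: swap_lipschitz_def)
  next
    case (Suc t)
    then show ?case
      using swap_lipschitz_set_op[OF Suc, of n] r assms by (simp add: H_def r_def mult_ac)
  qed
  note labels = this
  have \<psi>: "perm_mean k (H s) J = \<psi> s (card J)" if "J \<subseteq> {1..k}" for s J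
  proof -
    have "card J \<le> k" using card_mono[OF _ that] by simp
    then show ?thesis unfolding \<psi>_def using that by (intro perm_mean_cong_card) auto
  qed
  have \<psi>_Suc: "\<psi> (Suc s) j = size_op k n (\<psi> s) j" if "1 \<le> j" "j \<le> n" for s j
  proof -
    have j: "{1..j} \<subseteq> {1..k}" "{1..j} \<noteq> {}" using that assms by auto
    have "\<psi> (Suc s) j = set_op k n (perm_mean k (H s)) {1..j}"
      unfolding \<psi>_def set_op_perm_mean[OF j(1)] by (simp add: H_def)
    also have "\<dots> = set_op k n (\<lambda>J. \<psi> s (card J)) {1..j}"
      by (rule set_op_cong) (rule \<psi>)
    also have "\<dots> = size_op k n (\<psi> s) j" using set_op_card[OF j] by simp
    finally show ?thesis .
  qed
  have \<psi>0: "\<bar>\<psi> 0 j\<bar> \<le> 1" for j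
  proof -
    have "\<bar>\<Sum>\<tau> | \<tau> permutes {1..k}. H 0 (\<tau> ` {1..j})\<bar> \<le> (\<Sum>\<tau> | \<tau> permutes {1..k}. 1)"
      by (intro order_trans[OF sum_abs] sum_mono H0)
    also have "\<dots> = fact k" using card_permutations[of "{1..k}" k] by simp
    finally show ?thesis by (simp add: \<psi>_def perm_mean_def abs_divide)
  qed
  have card_im: "1 \<le> card (v ` {..<n})" "card (v ` {..<n}) \<le> n" for v :: "nat \<Rightarrow> nat"
    using assms card_image_le[of "{..<n}" v] by (auto simp: Suc_le_eq card_gt_0_iff lessThan_empty_iff)
  have oscillation: "\<bar>\<psi> t j - \<psi> t i\<bar> \<le> osc" if "1 \<le> i" "i \<le> j" "j \<le> n" for i j
    unfolding osc_def by (rule size_op_iterate_oscillation) (use \<psi>0 \<psi>_Suc assms(2) that in auto)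
  have sizes: "\<bar>\<psi> t (card (u ` {..<n})) - \<psi> t (card (v ` {..<n}))\<bar> \<le> osc" for v :: "nat \<Rightarrow> nat"
    using oscillation[OF card_im(1)[of u] _ card_im(2)[of v]]
      oscillation[OF card_im(1)[of v] _ card_im(2)[of u]]
    by (cases "card (u ` {..<n}) \<le> card (v ` {..<n})") (simp_all add: abs_minus_commute)
  \<comment> \<open>Stationarity replaces \<open>\<epsilon>\<close> by \<open>H t\<close> under
    \<open>burnside_pi\<close>, and invariance under relabelling replaces \<open>H t\<close> by
    \<open>\<psi> t\<close>.\<close>
  have stationary: "(\<Sum>v\<in>states k n. burnside_pi k n v * \<epsilon> v) =
      (\<Sum>w\<in>states k n. burnside_pi k n w * \<psi> t (card (w ` {..<n})))"
  proof -
    have "(\<Sum>v\<in>states k n. burnside_pi k n v * \<epsilon> v) =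
        (\<Sum>v\<in>states k n. \<Sum>w\<in>states k n. burnside_pi k n w * burnsideK_pow k n t w v * \<epsilon> v)"
      using assms by (intro sum.cong refl) (simp add: burnside_stationary flip: sum_distrib_right)
    also have "\<dots> = (\<Sum>w\<in>states k n. burnside_pi k n w * (\<Sum>v\<in>states k n. burnsideK_pow k n t w v * \<epsilon> v))"
      by (subst sum.swap) (simp add: sum_distrib_left mult.assoc)
    also have "\<dots> = (\<Sum>w\<in>states k n. burnside_pi k n w * H t (w ` {..<n}))"
      using assms by (intro sum.cong refl) (simp add: burnsideK_pow_sum H_def)
    also have "\<dots> = (\<Sum>w\<in>states k n. burnside_pi k n w * perm_mean k (H t) (w ` {..<n}))"
      by (rule burnside_pi_sum_perm_mean[symmetric])
    also have "\<dots> = (\<Sum>w\<in>states k n. burnside_pi k n w * \<psi> t (card (w ` {..<n})))"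
      by (intro sum.cong refl arg_cong2[where f = "(*)"] \<psi> states_image)
    finally show ?thesis .
  qed
  have "2 * tv_dist k n t u = (\<Sum>v\<in>states k n. burnsideK_pow k n t u v * \<epsilon> v - burnside_pi k n v * \<epsilon> v)"
    unfolding tv_dist_def by (simp add: \<epsilon>_def) (intro sum.cong; auto)
  also have "\<dots> = H t (u ` {..<n}) - (\<Sum>w\<in>states k n. burnside_pi k n w * \<psi> t (card (w ` {..<n})))"
    using assms by (simp add: sum_subtractf stationary burnsideK_pow_sum H_def)
  also have "\<dots> = (H t (u ` {..<n}) - \<psi> t (card (u ` {..<n}))) +
      (\<Sum>w\<in>states k n. burnside_pi k n w * (\<psi> t (card (u ` {..<n})) - \<psi> t (card (w ` {..<n}))))"
    using burnside_pi_sum[OF assms(2)]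
    by (simp add: right_diff_distrib sum_subtractf flip: sum_distrib_right)
  also have "\<dots> \<le> real n * (2 * r ^ t) + osc"
  proof (rule add_mono)
    have "H t (u ` {..<n}) - \<psi> t (card (u ` {..<n})) \<le> real (card (u ` {..<n})) * (2 * r ^ t)"
      using perm_mean_diff_bound[OF labels states_image[OF assms(3)], of t] r
      by (simp add: \<psi>[OF states_image[OF assms(3)], symmetric])
    also have "\<dots> \<le> real n * (2 * r ^ t)" using card_im r by (intro mult_right_mono) auto
    finally show "H t (u ` {..<n}) - \<psi> t (card (u ` {..<n})) \<le> real n * (2 * r ^ t)" .
    have "(\<Sum>w\<in>states k n. burnside_pi k n w * (\<psi> t (card (u ` {..<n})) - \<psi> t (card (w ` {..<n})))) \<le>
        (\<Sum>w\<in>states k n. burnside_pi k n w * osc)"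
      using sizes by (intro sum_mono mult_left_mono burnside_pi_nonneg) (simp add: abs_le_iff)
    also have "\<dots> = osc" using burnside_pi_sum[OF assms(2)] by (simp flip: sum_distrib_right)
    finally show "(\<Sum>w\<in>states k n. burnside_pi k n w * (\<psi> t (card (u ` {..<n})) - \<psi> t (card (w ` {..<n})))) \<le> osc" .
  qed
  finally show ?thesis by (simp add: osc_def r_def mult_ac)
qed

section \<open>Combining the two rates\<close>

text \<open>Here \<open>n * b\<close> is the bound aimed at. As a total variation distance is at most \<open>1\<close>, only
  the case \<open>n * b \<le> 1\<close> matters, and there the margin in the two rates absorbs the constants.\<close>

lemma two_rates_le:
  fixes b l \<rho> :: real
  assumes n: "2 \<le> n" "n \<le> k" and b: "0 < b" "real n * b \<le> 1"
    and l: "l \<le> b\<^sup>2" and \<rho>: "0 \<le> \<rho>" "\<rho> ^ 3 \<le> b ^ 4"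
  shows "real n * l + real (n - 1) * (3 * real k - 1 - real n) / (3 * real k - 2 * real n + 1) * \<rho> \<le> real n * b"
proof -
  define Q where "Q = (3 * real k - 1 - real n) / (3 * real k - 2 * real n + 1)"
  have k: "real k \<ge> real n" "real n \<ge> 2" using n by auto
  have "0 \<le> 3 * ((real n - 2) * (real k - real n))" using k by simp
  then have cross: "(3 * real k - 1 - real n) * (real n + 1) \<le> (2 * real n - 1) * (3 * real k - 2 * real n + 1)"
    by (simp add: algebra_simps)
  \<comment> \<open>Here \<open>Q = 1 + (n - 2) / (3 * k - 2 * n + 1)\<close>, which is largest at
    \<open>k = n\<close>.\<close>
  have Q: "Q \<le> (2 * real n - 1) / (real n + 1)"
  proof -
    have pos: "0 < 3 * real k - 2 * real n + 1" "0 < real n + 1" using k by auto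
    show ?thesis
      unfolding Q_def pos_divide_le_eq[OF pos(1)] times_divide_eq_left pos_le_divide_eq[OF pos(2)] by (rule cross)
  qed
  have Q0: "0 \<le> Q" using k by (simp add: Q_def)
  have "Q ^ 3 \<le> ((2 * real n - 1) / (real n + 1)) ^ 3"
    using Q Q0 by (rule power_mono)
  also have "\<dots> \<le> real n"
  proof -
    have "real n * (real n + 1) ^ 3 - (2 * real n - 1) ^ 3 =
        (real n)\<^sup>2 * (real n - 5 / 2)\<^sup>2 + 35 / 4 * (real n)\<^sup>2 - 5 * real n + 1"
      by (simp add: power2_eq_square power3_eq_cube algebra_simps)
    moreover have "35 / 4 * (real n)\<^sup>2 \<ge> 5 * real n"
      using k by (simp add: power2_eq_square)
    moreover have "(real n)\<^sup>2 * (real n - 5 / 2)\<^sup>2 \<ge> 0" by simp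
    ultimately have "(2 * real n - 1) ^ 3 \<le> real n * (real n + 1) ^ 3" by linarith
    then show ?thesis using k by (simp add: power_divide divide_le_eq)
  qed
  finally have Q3: "Q ^ 3 \<le> real n" .
  \<comment> \<open>The exponents 3 and 4 leave a spare factor b, which absorbs
    \<open>Q ^ 3 \<le> n\<close> because \<open>n * b \<le> 1\<close>.\<close>
  have "(Q * \<rho>) ^ 3 \<le> real n * b ^ 4"
    unfolding power_mult_distrib using Q3 \<rho> by (intro mult_mono) auto
  also have "\<dots> = (real n * b) * b ^ 3" by (simp add: power4_eq_xxxx power3_eq_cube)
  also have "\<dots> \<le> b ^ 3" using b by (intro mult_left_le_one_le) auto
  finally have "(Q * \<rho>) ^ Suc 2 \<le> b ^ Suc 2" by simp
  then have "Q * \<rho> \<le> b" by (rule power_le_imp_le_base) (use b in simp)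
  then have "(real n - 1) * (Q * \<rho>) \<le> (real n - 1) * b" using k by (intro mult_left_mono) auto
  \<comment> \<open>The label term gets a share b of \<open>n * b\<close>, the size term the
    remaining \<open>(n - 1) * b\<close>.\<close>
  moreover have "real n * l \<le> b"
  proof -
    have "real n * l \<le> real n * b\<^sup>2" using l by (intro mult_left_mono) auto
    also have "\<dots> = (real n * b) * b" by (simp add: power2_eq_square)
    also have "\<dots> \<le> b" using b by (intro mult_left_le_one_le) auto
    finally show ?thesis .
  qed
  moreover have "real (n - 1) * (3 * real k - 1 - real n) / (3 * real k - 2 * real n + 1) * \<rho> =
      (real n - 1) * (Q * \<rho>)"
    using n by (simp add: Q_def of_nat_diff)
  ultimately show ?thesis by (simp add: left_diff_distrib)
qed

lemma label_rate_le:
  assumes "2 \<le> k"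
  shows "(real k - 2) / (real k - 1) \<le> (1 - 1 / (2 * real k))\<^sup>2"
proof -
  have "(real k - 2) / (real k - 1) \<le> 1 - 1 / real k" using assms by (simp add: field_simps)
  also have "\<dots> \<le> (1 - 1 / (2 * real k))\<^sup>2" by (simp add: power2_eq_square algebra_simps)
  finally show ?thesis .
qed

text \<open>With \<open>z = 1 / k\<close>, the powers \<open>(1 - 2 * z / 3) ^ 3\<close> and
  \<open>(1 - z / 2) ^ 4\<close> agree to first order, and their difference is
  \<open>z\<^sup>2\<close> times a factor that is nonnegative for
  \<open>z \<le> 1 / 2\<close>.\<close>

lemma size_rate_le:
  assumes "2 \<le> k"
  shows "(1 - 2 / (3 * real k - 3)) ^ 3 \<le> (1 - 1 / (2 * real k)) ^ 4"
proof -
  define z where "z = 1 / real k"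
  have z: "0 \<le> z" "z \<le> 1 / 2" using assms by (auto simp: z_def field_simps)
  have "0 \<le> 1 - 2 / (3 * real k - 3)" "1 - 2 / (3 * real k - 3) \<le> 1 - 2 * z / 3"
    using assms by (auto simp: z_def field_simps)
  then have "(1 - 2 / (3 * real k - 3)) ^ 3 \<le> (1 - 2 * z / 3) ^ 3" by (intro power_mono)
  also have "\<dots> \<le> (1 - z / 2) ^ 4"
  proof -
    have "(1 - z / 2) ^ 4 - (1 - 2 * z / 3) ^ 3 = z\<^sup>2 * (1 / 6 - 11 / 54 * z + z\<^sup>2 / 16)"
      by (simp add: power2_eq_square power3_eq_cube power4_eq_xxxx field_simps)
    moreover have "0 \<le> 1 / 6 - 11 / 54 * z + z\<^sup>2 / 16"
      using z zero_le_power2[of z] by linarith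
    ultimately show ?thesis by (metis diff_ge_0_iff_ge mult_nonneg_nonneg zero_le_power2)
  qed
  finally show ?thesis by (simp add: z_def mult.commute)
qed

lemma tv_dist_le_geometric:
  assumes "1 \<le> n" "n \<le> k" "u \<in> states k n"
  shows "tv_dist k n t u \<le> real n * (1 - 1 / (2 * real k)) ^ t"
proof -
  define y where "y = 1 - 1 / (2 * real k)"
  define r where "r = (real k - 2) / (real k - 1)"
  have y: "0 < y" using assms by (simp add: y_def field_simps)
  \<comment> \<open>For \<open>k = 1\<close> division by zero makes r equal to 0.\<close>
  have r: "0 \<le> r" "r \<le> y\<^sup>2"
    using assms label_rate_le[of k] y by (cases "k = 1"; simp add: r_def y_def)+
  have y1: "y\<^sup>2 \<le> y" using y by (simp add: power2_eq_square y_def mult_left_le_one_le)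
  consider "t = 0" | "t \<ge> 1" "n = 1" | "t \<ge> 1" "n \<ge> 2" "real n * y ^ t \<ge> 1" | "t \<ge> 1" "n \<ge> 2" "real n * y ^ t \<le> 1"
    using assms by linarith
  then show ?thesis
  proof cases
    case 1
    then show ?thesis using tv_dist_le_1[OF assms, of t] assms by simp
  next
    \<comment> \<open>A single coordinate means a single block, so the size term vanishes.\<close>
    case 2
    have "tv_dist k n t u \<le> r ^ t"
      using tv_dist_le_two_rates[OF assms 2(1)] 2 by (simp add: r_def)
    also have "\<dots> \<le> y ^ t" using r y1 by (intro power_mono) auto
    finally show ?thesis using 2 by (simp add: y_def)
  next
    case 3
    then show ?thesis using tv_dist_le_1[OF assms, of t] by (simp add: y_def)
  next
    case 4
    have k: "2 \<le> k" using 4 assms by simp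
    have "tv_dist k n t u \<le> real n * r ^ t +
      real (n - 1) * (3 * real k - 1 - real n) / (3 * real k - 2 * real n + 1) * (1 - 2 / (3 * real k - 3)) ^ t"
      using tv_dist_le_two_rates[OF assms 4(1)] by (simp add: r_def)
    also have "\<dots> \<le> real n * y ^ t"
    proof (rule two_rates_le)
      show "r ^ t \<le> (y ^ t)\<^sup>2"
        using r power_mono[of r "y\<^sup>2" t] by (simp add: power_mult [symmetric] mult.commute)
      have pos: "0 \<le> 1 - 2 / (3 * real k - 3)" using k by (simp add: field_simps)
      then show "0 \<le> (1 - 2 / (3 * real k - 3)) ^ t" by simp
      have "((1 - 2 / (3 * real k - 3)) ^ 3) ^ t \<le> (y ^ 4) ^ t"
        using size_rate_le[OF k] pos by (intro power_mono) (auto simp: y_def)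
      then show "((1 - 2 / (3 * real k - 3)) ^ t) ^ 3 \<le> (y ^ t) ^ 4"
        by (simp add: power_mult [symmetric] mult.commute)
    qed (use assms y 4 in auto)
    finally show ?thesis by (simp add: y_def)
  qed
qed

section \<open>Bound for the mixing time\<close>

lemma tv_dist_0:
  assumes "1 \<le> n" "n \<le> k" "u \<in> states k n"
  shows "tv_dist k n 0 u = 1 - burnside_pi k n u"
proof -
  have sum: "burnside_pi k n u + (\<Sum>v\<in>states k n - {u}. burnside_pi k n v) = 1"
    using burnside_pi_sum[OF assms(2)] sum.remove[OF finite_states assms(3), of "burnside_pi k n"] by simp
  have "0 \<le> (\<Sum>v\<in>states k n - {u}. burnside_pi k n v)"
    by (intro sum_nonneg burnside_pi_nonneg)
  then have le: "burnside_pi k n u \<le> 1" using sum by simp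
  have "(\<Sum>v\<in>states k n. \<bar>burnsideK_pow k n 0 u v - burnside_pi k n v\<bar>) =
      (1 - burnside_pi k n u) + (\<Sum>v\<in>states k n - {u}. \<bar>burnsideK_pow k n 0 u v - burnside_pi k n v\<bar>)"
    using le by (simp add: sum.remove[OF finite_states assms(3)])
  also have "(\<Sum>v\<in>states k n - {u}. \<bar>burnsideK_pow k n 0 u v - burnside_pi k n v\<bar>) =
      (\<Sum>v\<in>states k n - {u}. burnside_pi k n v)"
    using burnside_pi_nonneg[of k n] by (intro sum.cong) auto
  finally show ?thesis using sum by (simp add: tv_dist_def)
qed

text \<open>For \<open>n = 1\<close> all states lie in one orbit. At \<open>t = 0\<close> the bound
  with exponent \<open>t + 1\<close> is then below 1, so the exact initial distance is
  required.\<close>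

lemma burnside_pi_one:
  assumes "1 \<le> k" "u \<in> states k 1"
  shows "burnside_pi k 1 u = 1 / real k"
proof -
  have "burnside_pi k 1 v = burnside_pi k 1 u" if "v \<in> states k 1" for v
    using that assms by (simp add: burnside_pi_eq lessThan_Suc)
  then have "real (card (states k 1)) * burnside_pi k 1 u = (\<Sum>v\<in>states k 1. burnside_pi k 1 v)"
    by simp
  also have "\<dots> = 1" using assms by (intro burnside_pi_sum)
  also have "card (states k 1) = k" by (simp add: states_def card_PiE)
  finally show ?thesis using assms by (simp add: field_simps)
qed

text \<open>The exponent \<open>t + 1\<close> instead of \<open>t\<close> pays for rounding the mixing time down to an integer.\<close>

lemma tv_dist_le_exp_Suc:
  assumes "1 \<le> n" "n \<le> k" "u \<in> states k n"
  shows "tv_dist k n t u \<le> real n * exp (- (real t + 1) / (2 * real k))"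
proof -
  define b where "b = exp (- (real t + 1) / (2 * real k))"
  define r where "r = (real k - 2) / (real k - 1)"
  have r_le: "r ^ t \<le> exp (- real t / (real k - 1))" if "2 \<le> k"
  proof -
    have "r = 1 + - 1 / (real k - 1)" using that by (simp add: r_def field_simps)
    also have "\<dots> \<le> exp (- 1 / (real k - 1))" by (rule exp_ge_add_one_self)
    finally have "r ^ t \<le> exp (- 1 / (real k - 1)) ^ t"
      using that by (intro power_mono) (auto simp: r_def)
    then show ?thesis by (simp flip: exp_of_nat_mult)
  qed
  consider "n = 1" "t = 0" | "n = 1" "t \<ge> 1" "k = 1" | "n = 1" "t \<ge> 1" "k \<ge> 2" | "n \<ge> 2" "real n * b \<ge> 1" | "n \<ge> 2" "real n * b < 1"
    using assms by linarith
  then show ?thesis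
  proof cases
    case 1
    have "tv_dist k n t u = 1 - 1 / real k"
      using tv_dist_0[OF assms] burnside_pi_one[of k u] assms 1 by simp
    also have "\<dots> \<le> 1 + - 1 / (2 * real k)" using assms by (simp add: field_simps)
    also have "\<dots> \<le> exp (- 1 / (2 * real k))" by (rule exp_ge_add_one_self)
    finally show ?thesis using 1 by simp
  next
    \<comment> \<open>For \<open>k = 1\<close> the label rate is \<open>-1 / 0 = 0\<close>, so the
      distance is 0 from the first step on.\<close>
    case 2
    then show ?thesis using tv_dist_le_two_rates[OF assms 2(2)] by (simp add: power_0_left order_trans[OF _ exp_ge_zero])
  next
    case 3
    have "tv_dist k n t u \<le> r ^ t"
      using tv_dist_le_two_rates[OF assms 3(2)] 3 by (simp add: r_def)
    also have "\<dots> \<le> exp (- real t / (real k - 1))" using 3 by (intro r_le)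
    also have "\<dots> \<le> b"
    proof -
      \<comment> \<open>The label rate is at least twice the target rate, which pays for the extra 1
        since \<open>t + 1 \<le> 2 * t\<close>.\<close>
      have "(real t + 1) / (2 * real k) \<le> (2 * real t) / (2 * real k)"
        using 3 by (intro divide_right_mono) auto
      also have "\<dots> \<le> real t / (real k - 1)" using 3 by (simp add: frac_le)
      finally have "- real t / (real k - 1) \<le> - (real t + 1) / (2 * real k)"
        unfolding minus_divide_left [symmetric] by (rule le_imp_neg_le)
      then show ?thesis unfolding b_def exp_le_cancel_iff .
    qed
    finally show ?thesis using 3 by (simp add: b_def)
  next
    case 4
    then show ?thesis using tv_dist_le_1[OF assms, of t] by (simp add: b_def)
  next
    case 5
    have k: "2 \<le> k" using 5 assms by simp
    \<comment> \<open>Otherwise \<open>b \<ge> exp (- (1 / 2)) \<ge> 1 / 2\<close>, and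
      \<open>n \<ge> 2\<close> contradicts \<open>n * b < 1\<close>.\<close>
    have "t + 1 > k"
    proof (rule ccontr)
      assume "\<not> t + 1 > k"
      then have "real t + 1 \<le> real k" by linarith
      then have "(real t + 1) / (2 * real k) \<le> 1 / 2" using k by (simp add: field_simps)
      then have "- (1 / 2) \<le> - (real t + 1) / (2 * real k)"
        by (simp only: minus_divide_left [symmetric] neg_le_iff_le)
      then have "exp (- (1 / 2)) \<le> b" unfolding b_def exp_le_cancel_iff .
      moreover have "1 / 2 \<le> exp (- (1 / 2 :: real))" using exp_ge_add_one_self[of "- (1 / 2)"] by simp
      ultimately have "1 \<le> 2 * b" by linarith
      also have "\<dots> \<le> real n * b" using 5 by (intro mult_right_mono) (auto simp: b_def)
      finally show False using 5 by simp
    qed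
    then have "k \<le> t" by simp
    \<comment> \<open>The rates involve \<open>k - 1\<close> instead of k; once
      \<open>k \<le> t\<close>, this gain covers the extra 1 in the exponent.\<close>
    then have tk: "(real t + 1) / real k \<le> real t / (real k - 1)" using k by (simp add: field_simps)
    have "tv_dist k n t u \<le> real n * r ^ t +
      real (n - 1) * (3 * real k - 1 - real n) / (3 * real k - 2 * real n + 1) * (1 - 2 / (3 * real k - 3)) ^ t"
      using tv_dist_le_two_rates[OF assms, of t] \<open>k \<le> t\<close> k by (simp add: r_def)
    also have "\<dots> \<le> real n * b"
    proof (rule two_rates_le)
      have "r ^ t \<le> exp (- real t / (real k - 1))" using k by (rule r_le)
      also have "\<dots> \<le> exp (2 * (- (real t + 1) / (2 * real k)))"
      proof -
        have "2 * (- (real t + 1) / (2 * real k)) = - ((real t + 1) / real k)"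
          using k by (simp add: divide_simps)
        then show ?thesis using tk by (simp only: exp_le_cancel_iff minus_divide_left [symmetric] neg_le_iff_le)
      qed
      also have "\<dots> = b\<^sup>2" by (simp only: b_def exp_double)
      finally show "r ^ t \<le> b\<^sup>2" .
      have pos: "0 \<le> 1 - 2 / (3 * real k - 3)" using k by (simp add: field_simps)
      then show "0 \<le> (1 - 2 / (3 * real k - 3)) ^ t" by simp
      have "1 - 2 / (3 * real k - 3) = 1 + - 2 / (3 * real k - 3)" by simp
      also have "\<dots> \<le> exp (- 2 / (3 * real k - 3))" by (rule exp_ge_add_one_self)
      finally have "((1 - 2 / (3 * real k - 3)) ^ t) ^ 3 \<le> (exp (- 2 / (3 * real k - 3)) ^ t) ^ 3"
        using pos by (intro power_mono) auto
      also have "\<dots> = exp (- 2 * (real t / (real k - 1)))"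
      proof -
        have "3 * (real t * (- 2 / (3 * (real k - 1)))) = - 2 * (real t / (real k - 1))"
          using k by (simp add: divide_simps)
        then show ?thesis by (simp add: right_diff_distrib flip: exp_of_nat_mult)
      qed
      also have "\<dots> \<le> exp (- 2 * ((real t + 1) / real k))"
        unfolding exp_le_cancel_iff by (rule mult_left_mono_neg[OF tk]) simp
      also have "\<dots> = b ^ 4"
      proof -
        have "4 * (- (real t + 1) / (2 * real k)) = - 2 * ((real t + 1) / real k)"
          using k by (simp add: divide_simps)
        then show ?thesis by (simp add: b_def flip: exp_of_nat_mult)
      qed
      finally show "((1 - 2 / (3 * real k - 3)) ^ t) ^ 3 \<le> b ^ 4" .
    qed (use assms 5 in \<open>auto simp: b_def\<close>)
    finally show ?thesis by (simp add: b_def)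
  qed
qed

theorem theorem1p1:
  fixes n k :: nat
  assumes "1 \<le> n" and "n \<le> k"
  shows "(\<forall>u \<in> states k n. \<forall>t::nat.
            tv_dist k n t u \<le> real n * (1 - 1 / (2 * real k)) ^ t)
       \<and> (\<forall>\<epsilon>::real. 0 < \<epsilon> \<and> \<epsilon> \<le> real n \<longrightarrow>
            real (tmix k n \<epsilon>) \<le> 2 * real k * ln (real n / \<epsilon>))"
proof (intro conjI ballI allI impI)
  fix u t assume "u \<in> states k n"
  then show "tv_dist k n t u \<le> real n * (1 - 1 / (2 * real k)) ^ t"
    using assms by (intro tv_dist_le_geometric)
next
  fix \<epsilon> :: real assume \<epsilon>: "0 < \<epsilon> \<and> \<epsilon> \<le> real n"
  define s where "s = 2 * real k * ln (real n / \<epsilon>)"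
  \<comment> \<open>As \<open>s \<le> T + 1\<close>, the bound with exponent \<open>T + 1\<close> is
    already at most \<open>\<epsilon>\<close> at the rounded-down time. The condition
    \<open>\<epsilon> \<le> n\<close> makes s nonnegative.\<close>
  define T where "T = nat \<lfloor>s\<rfloor>"
  have "s \<ge> 0" using \<epsilon> by (simp add: s_def ln_ge_zero field_simps)
  then have T: "real T \<le> s" "s \<le> real T + 1" unfolding T_def by linarith+
  have "tv_dist k n T u \<le> \<epsilon>" if u: "u \<in> states k n" for u
  proof -
    have "tv_dist k n T u \<le> real n * exp (- (real T + 1) / (2 * real k))"
      using assms u by (intro tv_dist_le_exp_Suc)
    also have "\<dots> \<le> real n * exp (- s / (2 * real k))"
      using T by (intro mult_left_mono exp_le_cancel_iff[THEN iffD2] divide_right_mono) auto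
    also have "- s / (2 * real k) = - ln (real n / \<epsilon>)" using assms by (simp add: s_def)
    also have "real n * exp (- ln (real n / \<epsilon>)) = \<epsilon>"
      using \<epsilon> assms by (simp add: exp_minus)
    finally show ?thesis .
  qed
  then have "tmix k n \<epsilon> \<le> T" unfolding tmix_def by (intro Least_le) auto
  then show "real (tmix k n \<epsilon>) \<le> 2 * real k * ln (real n / \<epsilon>)" using T by (simp add: s_def)
qed

end
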